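(* Let $p\ge 2$, $s\in(0,1)$, $M>0$, let $\Omega\subset\mathbb{R}^n$ be a bounded domain, and let $g\in W^{s,p}(\mathbb{R}^n)$ satisfy $g\ge 0$ a.e. in $\mathbb{R}^n\setminus\Omega$. Then there exists a minimizer of $\mathcal I_M$ in $\mathcal A_g(\Omega)$. Moreover, every minimizer $u$ of $\mathcal I_M$ in $\mathcal A_g(\Omega)$ satisfies $u\ge 0$ a.e. in $\mathbb{R}^n$ and is a weak subsolution of the homogeneous fractional $p$-Laplace equation in $\Omega$.
   Context: $W^{s,p}(\mathbb{R}^n)$ is the space of $u\in L^p(\mathbb{R}^n)$ with $[u]_{W^{s,p}(\mathbb{R}^n)}^p:=\int_{\mathbb{R}^n}\int_{\mathbb{R}^n}\frac{|u(x)-u(y)|^p}{|x-y|^{n+sp}}\,dx\,dy<\infty$. The functional is $\mathcal I_M(u):=\int_{\mathbb{R}^n}\int_{\mathbb{R}^n}\frac{|u(x)-u(y)|^p}{|x-y|^{n+sp}}\,dx\,dy+M\,|\{u>0\}\cap\Omega|$, where $|\cdot|$ is Lebesgue measure, and $\mathcal A_g(\Omega):=\{v\in W^{s,p}(\mathbb{R}^n): v=g\text{ a.e. in }\mathbb{R}^n\setminus\Omega\}$. A minimizer of $\mathcal I_M$ in $\mathcal A_g(\Omega)$ is a $u\in\mathcal A_g(\Omega)$ with $\mathcal I_M(u)\le\mathcal I_M(v)$ for every $v\in\mathcal A_g(\Omega)$. For an open set $D$, $W^{s,p}_0(D):=\{\varphi\in W^{s,p}(\mathbb{R}^n):\varphi=0\text{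 a.e. in }\mathbb{R}^n\setminus D\}$. With $j_p(t):=|t|^{p-2}t$ set $\mathcal E(u,\varphi):=\int_{\mathbb{R}^n}\int_{\mathbb{R}^n}\frac{j_p(u(x)-u(y))(\varphi(x)-\varphi(y))}{|x-y|^{n+sp}}\,dx\,dy$. A function $u\in W^{s,p}(\mathbb{R}^n)$ is a weak subsolution of the homogeneous fractional $p$-Laplace equation in $\Omega$ if $\mathcal E(u,\varphi)\le 0$ for every nonnegative $\varphi\in W^{s,p}_0(\Omega)$. *)

theory Defs
  imports "HOL-Analysis.Analysis"
begin

text \<open>
  Elements of Lebesgue and Sobolev spaces are represented by Lebesgue measurable functions rather
  than by classes modulo null sets; accordingly, every pointwise relation between them is required
  almost everywhere. Double integrals are taken over the product measure. On the diagonal the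
  integrands below have the value 0, as \<open>0 powr a = 0\<close>; the diagonal is a null set.
\<close>

definition domain :: "'a::euclidean_space set \<Rightarrow> bool" where
  "domain \<Omega> \<longleftrightarrow> open \<Omega> \<and> connected \<Omega> \<and> \<Omega> \<noteq> {}"

text \<open>The \<open>p\<close>-th power of the Gagliardo seminorm, possibly infinite.\<close>

definition seminorm_pow :: "real \<Rightarrow> real \<Rightarrow> ('a::euclidean_space \<Rightarrow> real) \<Rightarrow> ennreal" where
  "seminorm_pow s p u =
    (\<integral>\<^sup>+ (x, y). ennreal (\<bar>u x - u y\<bar> powr p / norm (x - y) powr (real DIM('a) + s * p))
      \<partial>(lebesgue \<Otimes>\<^sub>M lebesgue))"

definition Lp :: "real \<Rightarrow> ('a::euclidean_space \<Rightarrow> real) set" where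
  "Lp p = {u. u \<in> borel_measurable lebesgue \<and> integrable lebesgue (\<lambda>x. \<bar>u x\<bar> powr p)}"

definition Wsp :: "real \<Rightarrow> real \<Rightarrow> ('a::euclidean_space \<Rightarrow> real) set" where
  "Wsp s p = {u \<in> Lp p. seminorm_pow s p u < \<infinity>}"

definition Wsp0 :: "real \<Rightarrow> real \<Rightarrow> 'a::euclidean_space set \<Rightarrow> ('a \<Rightarrow> real) set" where
  "Wsp0 s p D = {\<phi> \<in> Wsp s p. AE x in lebesgue. x \<notin> D \<longrightarrow> \<phi> x = 0}"

definition functional ::
    "real \<Rightarrow> real \<Rightarrow> 'a::euclidean_space set \<Rightarrow> real \<Rightarrow> ('a \<Rightarrow> real) \<Rightarrow> ennreal" where
  "functional s p \<Omega> M u =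
    seminorm_pow s p u + ennreal M * emeasure lebesgue ({x. u x > 0} \<inter> \<Omega>)"

definition admissible ::
    "real \<Rightarrow> real \<Rightarrow> 'a::euclidean_space set \<Rightarrow> ('a \<Rightarrow> real) \<Rightarrow> ('a \<Rightarrow> real) set" where
  "admissible s p \<Omega> g = {v \<in> Wsp s p. AE x in lebesgue. x \<notin> \<Omega> \<longrightarrow> v x = g x}"

definition minimizer ::
    "real \<Rightarrow> real \<Rightarrow> 'a::euclidean_space set \<Rightarrow> real \<Rightarrow> ('a \<Rightarrow> real) \<Rightarrow> ('a \<Rightarrow> real) \<Rightarrow> bool" where
  "minimizer s p \<Omega> M g u \<longleftrightarrow>
    u \<in> admissible s p \<Omega> g \<and>
    (\<forall>v \<in> admissible s p \<Omega> g. functional s p \<Omega> M u \<le> functional s p \<Omega> M v)"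

definition jp :: "real \<Rightarrow> real \<Rightarrow> real" where
  "jp p t = \<bar>t\<bar> powr (p - 2) * t"

text \<open>
  For \<open>u\<close> and \<open>\<phi>\<close> in \<open>Wsp s p\<close> with \<open>p > 1\<close> the integrand is integrable by Hoelder's inequality,
  so that the default value 0 of the Bochner integral is not involved.
\<close>

definition energy_form ::
    "real \<Rightarrow> real \<Rightarrow> ('a::euclidean_space \<Rightarrow> real) \<Rightarrow> ('a \<Rightarrow> real) \<Rightarrow> real" where
  "energy_form s p u \<phi> =
    (\<integral> (x, y). jp p (u x - u y) * (\<phi> x - \<phi> y) / norm (x - y) powr (real DIM('a) + s * p)
      \<partial>(lebesgue \<Otimes>\<^sub>M lebesgue))"

definition weak_subsolution ::
    "real \<Rightarrow> real \<Rightarrow> 'a::euclidean_space set \<Rightarrow> ('a \<Rightarrow> real) \<Rightarrow> bool" where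
  "weak_subsolution s p \<Omega> u \<longleftrightarrow>
    u \<in> Wsp s p \<and>
    (\<forall>\<phi> \<in> Wsp0 s p \<Omega>. (AE x in lebesgue. 0 \<le> \<phi> x) \<longrightarrow> energy_form s p u \<phi> \<le> 0)"

end

theory Submission
  imports Defs "HOL-Complex_Analysis.Great_Picard"
begin

text \<open>
  Existence is the direct method. A minimizing sequence \<open>u\<^sub>k\<close> is bounded in the seminorm, so
  \<open>u\<^sub>k - g\<close>, which vanishes off \<open>\<Omega>\<close>, has an a.e. convergent subsequence by a Rellich-type argument:
  replacing a function by its averages over the cells of a grid of mesh \<open>h\<close> changes it in \<open>L\<^sup>1\<close> by a
  quantity that tends to 0 with \<open>h\<close>, uniformly on seminorm-bounded sets, and the countably many
  averages can be made to converge along a diagonal subsequence. Fatou's lemma applies to both terms of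
  the functional. If \<open>u\<close> is a minimizer, comparison with its positive part forces
  \<open>\<bar>u\<^sup>+(x) - u\<^sup>+(y)\<bar> = \<bar>u(x) - u(y)\<bar>\<close> for almost all pairs, which fails whenever \<open>u(x) < 0 \<le> u(y)\<close>;
  since \<open>u \<ge> 0\<close> off \<open>\<Omega>\<close>, the set \<open>{u < 0}\<close> is null. Finally, for \<open>\<phi> \<ge> 0\<close> the competitor \<open>u - t\<phi>\<close>
  does not increase the measure term, so the seminorm of \<open>u\<close> is at most that of \<open>u - t\<phi>\<close>; convexity
  gives \<open>\<E>(u - t\<phi>, \<phi>) \<le> 0\<close>, and \<open>t \<rightarrow> 0\<close> gives the subsolution property.
\<close>

subsection \<open>The Gagliardo seminorm\<close>

text \<open>A countable cover by sets of finite \<open>lborel\<close> measure serves for the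
  completion as well, which has the same values on Borel sets. Tonelli and Fubini for pairs rest on
  this.\<close>

lemma sigma_finite_lebesgue: "sigma_finite_measure (lebesgue :: 'a::euclidean_space measure)"
proof -
  obtain A :: "'a set set" where "countable A" "A \<subseteq> sets lborel" "\<Union>A = space lborel"
    "\<forall>a\<in>A. emeasure lborel a \<noteq> \<infinity>"
    using lborel.sigma_finite_countable by auto
  then show ?thesis
    by (intro sigma_finite_measure.intro exI[of _ A]) (auto simp: subset_iff)
qed

interpretation lebesgue: sigma_finite_measure "lebesgue :: 'a::euclidean_space measure"
  by (rule sigma_finite_lebesgue)

interpretation lebesgue_pair: pair_sigma_finite "lebesgue :: 'a::euclidean_space measure"
  "lebesgue :: 'b::euclidean_space measure" ..

text \<open>Projections map into \<open>lebesgue\<close>, whereas \<open>norm\<close> and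
  subtraction are Borel functions; passing to the coarser Borel sets lets the two be
  composed.\<close>

lemma fst_borel_measurable_lebesgue_pair [measurable]:
  "fst \<in> borel_measurable ((lebesgue :: 'a::euclidean_space measure) \<Otimes>\<^sub>M M)"
  by (rule measurable_compose[OF measurable_fst]) (rule measurable_completion, simp)

lemma snd_borel_measurable_lebesgue_pair [measurable]:
  "snd \<in> borel_measurable (M \<Otimes>\<^sub>M (lebesgue :: 'a::euclidean_space measure))"
  by (rule measurable_compose[OF measurable_snd]) (rule measurable_completion, simp)

text \<open>The exceptional pairs lie in \<open>N \<times> UNIV \<union> UNIV \<times> N\<close>,
  which is null because \<open>0 * \<infinity> = 0\<close> in \<open>ennreal\<close>.\<close>

lemma AE_lebesgue_pairI:
  fixes P :: "'a::euclidean_space \<Rightarrow> bool"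
  assumes "AE x in lebesgue. P x"
  shows "AE z in lebesgue \<Otimes>\<^sub>M lebesgue. P (fst z) \<and> P (snd z)"
proof -
  obtain N where N: "{x. \<not> P x} \<subseteq> N" "N \<in> null_sets (lebesgue :: 'a measure)"
    using assms by (auto simp: eventually_ae_filter)
  have [measurable]: "N \<in> sets lebesgue" using N by auto
  have "N \<times> UNIV \<union> UNIV \<times> N \<in> null_sets ((lebesgue :: 'a measure) \<Otimes>\<^sub>M (lebesgue :: 'a measure))"
    using N(2) by (intro null_sets.Un) (auto simp: null_sets_def lebesgue.emeasure_pair_measure_Times)
  then show ?thesis
    by (rule AE_I') (use N(1) in auto)
qed

text \<open>The integrand of \<open>seminorm_pow\<close> as a function of the pair, so that
  pointwise bounds can be stated before integrating.\<close>

definition gagliardo :: "real \<Rightarrow> real \<Rightarrow> ('a::euclidean_space \<Rightarrow> real) \<Rightarrow> 'a \<times> 'a \<Rightarrow> real" where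
  "gagliardo s p u z = \<bar>u (fst z) - u (snd z)\<bar> powr p / norm (fst z - snd z) powr (real DIM('a) + s * p)"

lemma gagliardo_nonneg [simp]: "0 \<le> gagliardo s p u z"
  by (simp add: gagliardo_def)

lemma gagliardo_measurable [measurable]:
  assumes [measurable]: "u \<in> borel_measurable lebesgue"
  shows "gagliardo s p u \<in> borel_measurable (lebesgue \<Otimes>\<^sub>M lebesgue)"
  unfolding gagliardo_def by measurable

lemma seminorm_pow_eq: "seminorm_pow s p u = (\<integral>\<^sup>+ z. ennreal (gagliardo s p u z) \<partial>(lebesgue \<Otimes>\<^sub>M lebesgue))"
  by (simp add: seminorm_pow_def gagliardo_def case_prod_unfold)

text \<open>A sum is at most twice its larger term. The constant is cruder than the one from
  convexity, but the argument works for every \<open>p \<ge> 0\<close>.\<close>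

lemma abs_add_powr_le:
  fixes a b p :: real
  assumes "0 \<le> p"
  shows "\<bar>a + b\<bar> powr p \<le> 2 powr p * (\<bar>a\<bar> powr p + \<bar>b\<bar> powr p)"
proof -
  have "\<bar>a + b\<bar> powr p \<le> (2 * max \<bar>a\<bar> \<bar>b\<bar>) powr p"
    using assms by (intro powr_mono2) auto
  also have "\<dots> = 2 powr p * max \<bar>a\<bar> \<bar>b\<bar> powr p"
    by (simp add: powr_mult)
  also have "\<dots> \<le> 2 powr p * (\<bar>a\<bar> powr p + \<bar>b\<bar> powr p)"
    by (intro mult_left_mono) (auto simp: max_def)
  finally show ?thesis .
qed

lemma gagliardo_add_le:
  assumes "0 \<le> p"
  shows "gagliardo s p (\<lambda>x. u x + v x) z \<le> 2 powr p * (gagliardo s p u z + gagliardo s p v z)"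
proof -
  have "\<bar>u (fst z) + v (fst z) - (u (snd z) + v (snd z))\<bar> powr p
      \<le> 2 powr p * (\<bar>u (fst z) - u (snd z)\<bar> powr p + \<bar>v (fst z) - v (snd z)\<bar> powr p)"
    using abs_add_powr_le[OF assms, of "u (fst z) - u (snd z)" "v (fst z) - v (snd z)"]
    by (simp add: algebra_simps)
  from divide_right_mono[OF this, of "norm (fst z - snd z) powr (real DIM('a) + s * p)"]
  show ?thesis by (simp add: gagliardo_def add_divide_distrib distrib_left)
qed

lemma gagliardo_cmult: "gagliardo s p (\<lambda>x. c * u x) z = \<bar>c\<bar> powr p * gagliardo s p u z"
proof -
  have "\<bar>c * u (fst z) - c * u (snd z)\<bar> = \<bar>c\<bar> * \<bar>u (fst z) - u (snd z)\<bar>"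
    by (simp flip: right_diff_distrib add: abs_mult)
  then show ?thesis by (simp add: gagliardo_def powr_mult)
qed

lemma seminorm_pow_add_le:
  assumes "0 \<le> p" and [measurable]: "u \<in> borel_measurable lebesgue" "v \<in> borel_measurable lebesgue"
  shows "seminorm_pow s p (\<lambda>x. u x + v x) \<le> ennreal (2 powr p) * (seminorm_pow s p u + seminorm_pow s p v)"
proof -
  have "seminorm_pow s p (\<lambda>x. u x + v x)
      \<le> (\<integral>\<^sup>+ z. ennreal (2 powr p) * (ennreal (gagliardo s p u z) + ennreal (gagliardo s p v z)) \<partial>(lebesgue \<Otimes>\<^sub>M lebesgue))"
    unfolding seminorm_pow_eq using gagliardo_add_le[OF assms(1), of s u v]
    by (intro nn_integral_mono) (simp flip: ennreal_plus ennreal_mult)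
  also have "\<dots> = ennreal (2 powr p) * (seminorm_pow s p u + seminorm_pow s p v)"
    by (simp add: seminorm_pow_eq nn_integral_cmult nn_integral_add)
  finally show ?thesis .
qed

lemma seminorm_pow_cmult:
  assumes [measurable]: "u \<in> borel_measurable lebesgue"
  shows "seminorm_pow s p (\<lambda>x. c * u x) = ennreal (\<bar>c\<bar> powr p) * seminorm_pow s p u"
  by (simp add: seminorm_pow_eq gagliardo_cmult ennreal_mult nn_integral_cmult)

lemma seminorm_pow_cong_AE:
  assumes "AE x in lebesgue. u x = v x"
  shows "seminorm_pow s p u = seminorm_pow s p v"
  unfolding seminorm_pow_eq using AE_lebesgue_pairI[OF assms]
  by (intro nn_integral_cong_AE) (auto simp: gagliardo_def)

section \<open>The space \<open>Wsp\<close> under sums, multiples and almost everywhere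
  equality\<close>

lemma Lp_add:
  assumes "u \<in> Lp p" "v \<in> Lp p" "0 \<le> p"
  shows "(\<lambda>x. u x + v x) \<in> Lp p"
proof -
  have [measurable]: "u \<in> borel_measurable lebesgue" "v \<in> borel_measurable lebesgue"
    using assms by (auto simp: Lp_def)
  have "integrable lebesgue (\<lambda>x. 2 powr p * (\<bar>u x\<bar> powr p + \<bar>v x\<bar> powr p))"
    using assms by (auto simp: Lp_def)
  then have "integrable lebesgue (\<lambda>x. \<bar>u x + v x\<bar> powr p)"
    by (rule Bochner_Integration.integrable_bound) (use abs_add_powr_le[OF assms(3)] in auto)
  then show ?thesis by (simp add: Lp_def)
qed

lemma Wsp_measurable: "u \<in> Wsp s p \<Longrightarrow> u \<in> borel_measurable lebesgue"
  by (simp add: Wsp_def Lp_def)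

lemma Wsp_add:
  assumes "u \<in> Wsp s p" "v \<in> Wsp s p" "0 \<le> p"
  shows "(\<lambda>x. u x + v x) \<in> Wsp s p"
proof -
  have "seminorm_pow s p (\<lambda>x. u x + v x) \<le> ennreal (2 powr p) * (seminorm_pow s p u + seminorm_pow s p v)"
    using assms by (intro seminorm_pow_add_le) (auto dest: Wsp_measurable)
  also have "\<dots> < \<infinity>"
    using assms by (auto simp: Wsp_def ennreal_mult_less_top)
  finally show ?thesis using assms Lp_add by (auto simp: Wsp_def)
qed

lemma Wsp_cmult:
  assumes "u \<in> Wsp s p"
  shows "(\<lambda>x. c * u x) \<in> Wsp s p"
  using assms
  by (auto simp: Wsp_def Lp_def seminorm_pow_cmult ennreal_mult_less_top abs_mult powr_mult)

lemma Wsp_diff: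
  assumes "u \<in> Wsp s p" "v \<in> Wsp s p" "0 \<le> p"
  shows "(\<lambda>x. u x - v x) \<in> Wsp s p"
  using Wsp_add[OF assms(1) Wsp_cmult[OF assms(2), of "-1"] assms(3)] by simp

lemma Wsp_cong_AE:
  assumes "u \<in> Wsp s p" "v \<in> borel_measurable lebesgue" "AE x in lebesgue. v x = u x"
  shows "v \<in> Wsp s p"
proof -
  have [measurable]: "u \<in> borel_measurable lebesgue" "v \<in> borel_measurable lebesgue"
    using assms by (auto simp: Wsp_measurable)
  have "integrable lebesgue (\<lambda>x. \<bar>v x\<bar> powr p) \<longleftrightarrow> integrable lebesgue (\<lambda>x. \<bar>u x\<bar> powr p)"
    using assms(3) by (intro integrable_cong_AE) auto
  then show ?thesis using assms seminorm_pow_cong_AE[OF assms(3)]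
    by (simp add: Wsp_def Lp_def)
qed

text \<open>Comparison and Fatou-type arguments deliver membership in this form, as finiteness of
  two nonnegative integrals.\<close>

lemma Wsp_iff_nn_integral:
  "u \<in> Wsp s p \<longleftrightarrow> u \<in> borel_measurable lebesgue \<and> (\<integral>\<^sup>+ x. ennreal (\<bar>u x\<bar> powr p) \<partial>lebesgue) < \<infinity>
    \<and> seminorm_pow s p u < \<infinity>"
  by (auto simp: Wsp_def Lp_def integrable_iff_bounded)

text \<open>
  The values of \<open>v\<close> are compared with its values 0 on a unit ball at bounded distance from \<open>\<Omega>\<close>.
\<close>

lemma poincare_bounded_support:
  fixes \<Omega> :: "'a::euclidean_space set"
  assumes "bounded \<Omega>" "0 \<le> s" "0 \<le> p"
  obtains C :: real where "0 \<le> C"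
    "\<And>v. v \<in> borel_measurable lebesgue \<Longrightarrow> (\<And>x. x \<notin> \<Omega> \<Longrightarrow> v x = 0) \<Longrightarrow>
      (\<integral>\<^sup>+ x. ennreal (\<bar>v x\<bar> powr p) \<partial>lebesgue) \<le> ennreal C * seminorm_pow s p v"
proof -
  obtain R where R: "0 < R" "\<And>x. x \<in> \<Omega> \<Longrightarrow> norm x \<le> R"
    using assms(1) bounded_pos by blast
  obtain b :: 'a where b: "b \<in> Basis" using nonempty_Basis by blast
  \<comment> \<open>The centre has norm \<open>R + 1\<close>, so this unit ball lies beyond the ball
    of radius \<open>R\<close> that contains \<open>\<Omega>\<close>, and \<open>v\<close> vanishes
    on it.\<close>
  define B where "B = ball ((R + 1) *\<^sub>R b) 1"
  have B: "R < norm y" "norm y < R + 2" if "y \<in> B" for y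
    using that R(1) b norm_triangle_ineq2[of "(R + 1) *\<^sub>R b" y] norm_triangle_ineq2[of y "(R + 1) *\<^sub>R b"]
    by (auto simp: B_def dist_norm norm_minus_commute)
  define q where "q = real DIM('a) + s * p"
  have "0 \<le> q" using assms by (simp add: q_def)
  \<comment> \<open>Points of \<open>\<Omega>\<close> and \<open>B\<close> are at distance at most
    \<open>R + (R + 2)\<close>, so \<open>D\<close> bounds the denominator of the Gagliardo
    integrand there.\<close>
  define D where "D = (2 * R + 2) powr q"
  have [measurable]: "B \<in> sets lebesgue" by (simp add: B_def)
  define c where "c = measure lborel B"
  have c: "0 < c" "emeasure lebesgue B = ennreal c"
    using content_ball_pos[of 1 "(R + 1) *\<^sub>R b"] emeasure_bounded_finite[OF bounded_ball, of "(R + 1) *\<^sub>R b" 1]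
    by (auto simp: B_def c_def less_top intro!: emeasure_eq_ennreal_measure)
  show ?thesis
  proof
    show "0 \<le> D / c" using c by (simp add: D_def)
    fix v :: "'a \<Rightarrow> real"
    assume [measurable]: "v \<in> borel_measurable lebesgue" and v0: "\<And>x. x \<notin> \<Omega> \<Longrightarrow> v x = 0"
    \<comment> \<open>The left side is 0 unless \<open>x\<close> is in \<open>\<Omega>\<close> and
      \<open>y\<close> is in \<open>B\<close>. Integrating over \<open>y\<close> gives
      \<open>\<bar>v x\<bar> powr p\<close> times the volume \<open>c\<close> of
      \<open>B\<close>.\<close>
    have pw: "\<bar>v x\<bar> powr p * indicator B y \<le> D * gagliardo s p v (x, y)" for x y
    proof (cases "y \<in> B \<and> x \<in> \<Omega>")
      case True
      then have *: "v y = 0" "norm (x - y) \<le> 2 * R + 2" "x \<noteq> y"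
        using v0[of y] R(2)[of y] R(2)[of x] B[of y] norm_triangle_ineq4[of x y] by auto
      then have "norm (x - y) powr q \<le> D"
        unfolding D_def using \<open>0 \<le> q\<close> by (intro powr_mono2) auto
      then have "\<bar>v x\<bar> powr p * norm (x - y) powr q \<le> D * \<bar>v x\<bar> powr p"
        by (subst mult.commute) (rule mult_right_mono, simp_all)
      then show ?thesis
        using True * by (simp add: gagliardo_def pos_le_divide_eq flip: q_def)
    qed (auto simp: v0 D_def split: split_indicator)
    have pw': "ennreal (\<bar>v x\<bar> powr p) * indicator B y \<le> ennreal D * ennreal (gagliardo s p v (x, y))" for x y
      using pw[of x y] by (cases "y \<in> B") (simp_all add: D_def ennreal_leI flip: ennreal_mult)
    have "(\<integral>\<^sup>+ x. ennreal (\<bar>v x\<bar> powr p) \<partial>lebesgue) * ennreal c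
        = (\<integral>\<^sup>+ x. \<integral>\<^sup>+ y. ennreal (\<bar>v x\<bar> powr p) * indicator B y \<partial>lebesgue \<partial>lebesgue)"
      using c(2) by (simp add: nn_integral_cmult_indicator nn_integral_multc)
    also have "\<dots> = (\<integral>\<^sup>+ z. ennreal (\<bar>v (fst z)\<bar> powr p) * indicator B (snd z) \<partial>(lebesgue \<Otimes>\<^sub>M lebesgue))"
      by (subst lebesgue.nn_integral_fst[symmetric]) auto
    also have "\<dots> \<le> (\<integral>\<^sup>+ z. ennreal D * ennreal (gagliardo s p v z) \<partial>(lebesgue \<Otimes>\<^sub>M lebesgue))"
      using pw' by (intro nn_integral_mono) (metis prod.collapse)
    also have "\<dots> = ennreal D * seminorm_pow s p v"
      by (simp add: nn_integral_cmult seminorm_pow_eq)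
    finally have "(\<integral>\<^sup>+ x. ennreal (\<bar>v x\<bar> powr p) \<partial>lebesgue) * ennreal c * ennreal (1 / c)
      \<le> ennreal D * seminorm_pow s p v * ennreal (1 / c)"
      by (rule mult_right_mono) simp
    moreover have "ennreal c * ennreal (1 / c) = 1"
      using c by (simp flip: ennreal_mult)
    moreover have "ennreal D * ennreal (1 / c) = ennreal (D / c)"
      using c by (simp add: D_def flip: ennreal_mult)
    ultimately show "(\<integral>\<^sup>+ x. ennreal (\<bar>v x\<bar> powr p) \<partial>lebesgue) \<le> ennreal (D / c) * seminorm_pow s p v"
      by (metis mult.assoc mult.commute mult.right_neutral)
  qed
qed

subsection \<open>Averages over grid cells\<close>

text \<open>The corner of the half-open cube of the grid \<open>h \<int>\<^sup>n\<close> that contains \<open>x\<close>; cells are its fibres.\<close>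

definition corner :: "real \<Rightarrow> 'a::euclidean_space \<Rightarrow> 'a" where
  "corner h x = (\<Sum>b\<in>Basis. (h * of_int \<lfloor>x \<bullet> b / h\<rfloor>) *\<^sub>R b)"

lemma corner_inner: "b \<in> Basis \<Longrightarrow> corner h x \<bullet> b = h * of_int \<lfloor>x \<bullet> b / h\<rfloor>"
  by (simp add: corner_def inner_sum_left_Basis)

lemma corner_borel_measurable [measurable]: "corner h \<in> borel_measurable borel"
  unfolding corner_def by measurable

lemma corner_measurable [measurable]: "corner h \<in> borel_measurable lebesgue"
  by (rule measurable_completion) (simp add: corner_borel_measurable)

text \<open>A corner is determined by finitely many integers. Countability of the cells is what
  permits a diagonal extraction over all of them.\<close>

lemma countable_range_corner: "countable (range (corner h :: 'a::euclidean_space \<Rightarrow> 'a))"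
proof -
  have "range (corner h :: 'a \<Rightarrow> 'a)
      \<subseteq> (\<lambda>f. \<Sum>b\<in>Basis. (h * of_int (f b)) *\<^sub>R b) ` (PiE Basis (\<lambda>_. UNIV :: int set))"
  proof
    fix a :: 'a assume "a \<in> range (corner h)"
    then obtain x where "a = corner h x" by auto
    then show "a \<in> (\<lambda>f. \<Sum>b\<in>Basis. (h * of_int (f b)) *\<^sub>R b) ` (PiE Basis (\<lambda>_. UNIV :: int set))"
      by (intro image_eqI[of _ _ "\<lambda>b\<in>Basis. \<lfloor>x \<bullet> b / h\<rfloor>"]) (auto simp: corner_def)
  qed
  moreover have "countable (PiE Basis (\<lambda>_ :: 'a. UNIV :: int set))"
    by (intro countable_PiE) auto
  ultimately show ?thesis by (rule countable_subset[OF _ countable_image])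
qed

lemma corner_inner_bounds:
  fixes x :: "'a::euclidean_space"
  assumes "0 < h" "b \<in> Basis"
  shows "corner h x \<bullet> b \<le> x \<bullet> b" "x \<bullet> b < corner h x \<bullet> b + h"
proof -
  show "corner h x \<bullet> b \<le> x \<bullet> b" "x \<bullet> b < corner h x \<bullet> b + h"
    using floor_divide_lower[OF assms(1), of "x \<bullet> b"] floor_divide_upper[OF assms(1), of "x \<bullet> b"] assms(2)
    by (simp_all add: corner_inner algebra_simps)
qed

text \<open>Each coordinate differs by at most \<open>h\<close>. The norm is bounded by the sum over
  coordinates, hence the dimension as a factor rather than its square root.\<close>

lemma norm_diff_le_if_corner_eq:
  fixes x y :: "'a::euclidean_space"
  assumes "0 < h" "corner h x = corner h y"
  shows "norm (x - y) \<le> real DIM('a) * h"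
proof -
  have "norm (x - y) \<le> (\<Sum>b\<in>Basis. \<bar>(x - y) \<bullet> b\<bar>)" by (rule norm_le_l1)
  also have "\<dots> \<le> (\<Sum>b\<in>(Basis :: 'a set). h)"
  proof (rule sum_mono)
    fix b :: 'a assume "b \<in> Basis"
    from corner_inner_bounds[OF assms(1) this, of x] corner_inner_bounds[OF assms(1) this, of y] assms(2)
    show "\<bar>(x - y) \<bullet> b\<bar> \<le> h" by (simp add: inner_diff_left)
  qed
  finally show ?thesis by simp
qed

text \<open>The cell lies between the open and the closed box of side \<open>h\<close> at its
  corner, and both have the same volume.\<close>

lemma emeasure_corner_fibre:
  fixes x :: "'a::euclidean_space"
  assumes "0 < h"
  shows "emeasure lebesgue {y. corner h y = corner h x} = ennreal (h ^ DIM('a))"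
proof -
  define a where "a = corner h x"
  define u where "u = a + h *\<^sub>R One"
  have u: "u \<bullet> b = a \<bullet> b + h" if "b \<in> Basis" for b
    using that by (simp add: u_def inner_add_left)
  have meas: "{y. corner h y = a} \<in> sets borel"
    using measurable_sets[OF corner_borel_measurable, of "{a}" h] by (simp add: vimage_def)
  have "box a u \<subseteq> {y. corner h y = a}"
  proof safe
    fix y assume y: "y \<in> box a u"
    show "corner h y = a"
    proof (rule euclidean_eqI)
      fix b :: 'a assume b: "b \<in> Basis"
      have "\<lfloor>y \<bullet> b / h\<rfloor> = \<lfloor>x \<bullet> b / h\<rfloor>"
        using y b assms corner_inner[OF b, of h x]
        by (intro floor_unique) (force simp: mem_box u a_def[symmetric] field_simps)+
      then show "corner h y \<bullet> b = a \<bullet> b" using b by (simp add: corner_inner a_def)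
    qed
  qed
  then have "emeasure lborel (box a u) \<le> emeasure lborel {y. corner h y = a}"
    using meas by (intro emeasure_mono) auto
  moreover have "{y. corner h y = a} \<subseteq> cbox a u"
  proof safe
    fix y assume "a = corner h y"
    then show "y \<in> cbox (corner h y) u"
      using corner_inner_bounds[OF assms, of _ y] by (simp add: mem_box u less_imp_le)
  qed
  then have "emeasure lborel {y. corner h y = a} \<le> emeasure lborel (cbox a u)"
    by (intro emeasure_mono) auto
  moreover have "emeasure lborel (box a u) = ennreal (h ^ DIM('a))"
    "emeasure lborel (cbox a u) = ennreal (h ^ DIM('a))"
    using assms u by (auto simp: u_def)
  ultimately show ?thesis using meas by (simp add: a_def)
qed

text \<open>The divisor is the volume of a cell, so this is the mean of \<open>w\<close> over the
  cell of \<open>x\<close>, a function that is constant on cells.\<close>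

definition cell_average :: "real \<Rightarrow> ('a::euclidean_space \<Rightarrow> real) \<Rightarrow> 'a \<Rightarrow> real" where
  "cell_average h w x = (\<integral>y. w y * indicator {y. corner h y = corner h x} y \<partial>lebesgue) / h ^ DIM('a)"

lemma corner_fibre_sets [measurable]: "{y. corner h y = a} \<in> sets lebesgue"
  using measurable_sets[OF corner_measurable, of "{a}" h] by (simp add: vimage_def)

text \<open>An integral depending on a parameter: lying in the same cell is a measurable relation on
  pairs because \<open>corner h\<close> is measurable.\<close>

lemma cell_average_measurable [measurable]:
  assumes [measurable]: "w \<in> borel_measurable lebesgue"
  shows "cell_average h w \<in> borel_measurable lebesgue"
proof -
  have "(\<lambda>z. w (snd z) * indicator {z. corner h (snd z) = corner h (fst z)} z)
      \<in> borel_measurable ((lebesgue :: 'a measure) \<Otimes>\<^sub>M (lebesgue :: 'a measure))"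
    by measurable
  then have "case_prod (\<lambda>x y. w y * indicator {y. corner h y = corner h x} y)
      \<in> borel_measurable ((lebesgue :: 'a measure) \<Otimes>\<^sub>M (lebesgue :: 'a measure))"
    by (simp add: case_prod_unfold indicator_def)
  from lebesgue.borel_measurable_lebesgue_integral[OF this] show ?thesis
    unfolding cell_average_def by measurable
qed

text \<open>For \<open>t > e\<close> write \<open>t\<close> as
  \<open>t powr (1 - p) * t powr p\<close> and use that the exponent \<open>1 - p\<close> is not
  positive. On sets of finite measure this turns a bound on \<open>p\<close>-th powers into an
  \<open>L\<^sup>1\<close> bound.\<close>

lemma le_add_powr_mult:
  fixes t e p :: real
  assumes "0 \<le> t" "0 < e" "1 \<le> p"
  shows "t \<le> e + e powr (1 - p) * t powr p"
proof (cases "t \<le> e")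
  case True
  then show ?thesis using assms by (simp add: add_increasing2)
next
  case False
  then have "t powr (1 - p) \<le> e powr (1 - p)"
    using assms by (intro powr_mono2') auto
  then have "t powr (1 - p) * t powr p \<le> e powr (1 - p) * t powr p"
    by (rule mult_right_mono) simp
  moreover have "t powr (1 - p) * t powr p = t"
    using False assms by (simp flip: powr_add)
  ultimately show ?thesis using assms by linarith
qed

text \<open>
  The term with \<open>e\<close> comes from \<open>t \<le> e + e\<^sup>1\<^sup>-\<^sup>p t\<^sup>p\<close>, which replaces Jensen's inequality. The second
  coefficient is a constant times \<open>h powr (s * p)\<close>.
\<close>

lemma cell_average_L1_error:
  fixes w :: "'a::euclidean_space \<Rightarrow> real"
  assumes h: "0 < h" and e: "0 < e" and p: "1 \<le> p" and s: "0 \<le> s"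
    and w: "integrable lebesgue w" and B [measurable]: "B \<in> sets lebesgue" and w0: "\<And>x. x \<notin> B \<Longrightarrow> w x = 0"
  shows "(\<integral>\<^sup>+ x. ennreal \<bar>w x - cell_average h w x\<bar> \<partial>lebesgue)
    \<le> ennreal (2 * e) * emeasure lebesgue B
      + ennreal (e powr (1 - p) * (real DIM('a) * h) powr (real DIM('a) + s * p) / h ^ DIM('a)) * seminorm_pow s p w"
proof -
  have [measurable]: "w \<in> borel_measurable lebesgue" using w by auto
  let ?n = "DIM('a)"
  define q where "q = real ?n + s * p"
  have "0 < q" using p s by (simp add: q_def add_pos_nonneg)
  \<comment> \<open>The averaging kernel: symmetric, with integral 1 in each variable, so that the
    cell average is the integral of \<open>w\<close> against \<open>I x\<close>.\<close>
  define I where "I x y = (indicator {y. corner h y = corner h x} y / h ^ ?n :: real)" for x y :: 'a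
  define A where "A = e powr (1 - p) * (real ?n * h) powr q / h ^ ?n"
  have "0 \<le> A" using h by (simp add: A_def)
  have I_nonneg [simp]: "0 \<le> I x y" for x y using h by (simp add: I_def)
  have I_sym: "I x y = I y x" for x y by (auto simp: I_def indicator_def)
  have I_int: "integrable lebesgue (\<lambda>y. I x y)" "(\<integral>y. I x y \<partial>lebesgue) = 1" for x
  proof -
    have "emeasure lebesgue {y. corner h y = corner h x} < \<infinity>"
      "measure lebesgue {y. corner h y = corner h x} = h ^ ?n"
      using h by (simp_all only: emeasure_corner_fibre[OF h] measure_def) auto
    then show "integrable lebesgue (\<lambda>y. I x y)" "(\<integral>y. I x y \<partial>lebesgue) = 1"
      unfolding I_def using h by (auto intro!: integrable_real_indicator)
  qed
  have I_nn: "(\<integral>\<^sup>+ y. ennreal (I x y) \<partial>lebesgue) = 1" for x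
    using I_int[of x] by (simp add: nn_integral_eq_integral)
  have I_meas [measurable]: "(\<lambda>z. I (fst z) (snd z)) \<in> borel_measurable (lebesgue \<Otimes>\<^sub>M lebesgue)"
  proof -
    have "(\<lambda>z. indicator {z. corner h (snd z) = corner h (fst z)} z / h ^ ?n :: real)
        \<in> borel_measurable ((lebesgue :: 'a measure) \<Otimes>\<^sub>M (lebesgue :: 'a measure))"
      by measurable
    then show ?thesis by (simp add: I_def indicator_def)
  qed
  have I_meas2 [measurable]: "(\<lambda>y. I x y) \<in> borel_measurable lebesgue" for x
    unfolding I_def by measurable
  have wI_int: "integrable lebesgue (\<lambda>y. w y * I x y)" for x
  proof (rule Bochner_Integration.integrable_bound)
    show "integrable lebesgue (\<lambda>y. w y * (1 / h ^ ?n))" using w by simp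
    show "AE y in lebesgue. norm (w y * I x y) \<le> norm (w y * (1 / h ^ ?n))"
      using h by (auto simp: I_def indicator_def)
  qed auto
  \<comment> \<open>The kernel restricts to pairs in one cell, where the distance is at most a
    multiple of \<open>h\<close>, which bounds the Gagliardo denominator. If the two values differ,
    one of the points lies in \<open>B\<close>, so the term \<open>e\<close> can be charged to
    \<open>B\<close>.\<close>
  have pw: "\<bar>w x - w y\<bar> * I x y \<le> e * indicator B x * I x y + e * indicator B y * I x y + A * gagliardo s p w (x, y)"
    for x y
  proof (cases "corner h y = corner h x \<and> w x \<noteq> w y")
    case False
    then have z: "\<bar>w x - w y\<bar> * I x y = 0" by (auto simp: I_def)
    show ?thesis unfolding z using e \<open>0 \<le> A\<close> by simp
  next
    case True
    then have ne: "x \<noteq> y" and "x \<in> B \<or> y \<in> B" using w0[of x] w0[of y] by (blast, metis)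
    then have 1: "e \<le> e * indicator B x + e * indicator B y"
      using e by (auto simp: indicator_def)
    define t where "t = \<bar>w x - w y\<bar>"
    have "norm (x - y) powr q \<le> (real ?n * h) powr q"
      using norm_diff_le_if_corner_eq[OF h, of x y] True \<open>0 < q\<close> by (intro powr_mono2) auto
    then have "t powr p * norm (x - y) powr q \<le> (real ?n * h) powr q * t powr p"
      by (subst mult.commute) (rule mult_right_mono, simp_all)
    then have 2: "t powr p \<le> (real ?n * h) powr q * gagliardo s p w (x, y)"
      using ne by (simp add: gagliardo_def pos_le_divide_eq t_def flip: q_def)
    have "t \<le> e + e powr (1 - p) * t powr p"
      by (rule le_add_powr_mult) (use e p in \<open>auto simp: t_def\<close>)
    also have "\<dots> \<le> e * indicator B x + e * indicator B y + e powr (1 - p) * ((real ?n * h) powr q * gagliardo s p w (x, y))"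
      by (intro add_mono mult_left_mono 1 2) simp
    finally have "t * I x y \<le> (e * indicator B x + e * indicator B y + e powr (1 - p) * ((real ?n * h) powr q * gagliardo s p w (x, y))) * I x y"
      by (rule mult_right_mono) simp
    moreover have "I x y = 1 / h ^ ?n" using True by (simp add: I_def)
    ultimately show ?thesis
      by (simp add: t_def A_def algebra_simps add_divide_distrib)
  qed
  \<comment> \<open>As the kernel has mass 1, \<open>w x\<close> is its own average, and the error
    is an average of \<open>w x - w y\<close> over the cell.\<close>
  have "ennreal \<bar>w x - cell_average h w x\<bar> \<le> (\<integral>\<^sup>+ y. ennreal (\<bar>w x - w y\<bar> * I x y) \<partial>lebesgue)" for x
  proof -
    have "cell_average h w x = (\<integral>y. w y * I x y \<partial>lebesgue)"
      by (simp add: cell_average_def I_def)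
    moreover have "w x = (\<integral>y. w x * I x y \<partial>lebesgue)"
      using I_int by simp
    ultimately have "w x - cell_average h w x = (\<integral>y. w x * I x y - w y * I x y \<partial>lebesgue)"
      using I_int wI_int by simp
    also have "ennreal (norm \<dots>) \<le> (\<integral>\<^sup>+ y. ennreal (norm (w x * I x y - w y * I x y)) \<partial>lebesgue)"
      by (rule integral_norm_bound_ennreal) (use I_int wI_int in auto)
    also have "\<dots> = (\<integral>\<^sup>+ y. ennreal (\<bar>w x - w y\<bar> * I x y) \<partial>lebesgue)"
      by (simp add: abs_mult flip: left_diff_distrib)
    finally show ?thesis by simp
  qed
  then have "(\<integral>\<^sup>+ x. ennreal \<bar>w x - cell_average h w x\<bar> \<partial>lebesgue)
      \<le> (\<integral>\<^sup>+ x. \<integral>\<^sup>+ y. ennreal (\<bar>w x - w y\<bar> * I x y) \<partial>lebesgue \<partial>lebesgue)"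
    by (rule nn_integral_mono)
  also have "\<dots> = (\<integral>\<^sup>+ z. ennreal (\<bar>w (fst z) - w (snd z)\<bar> * I (fst z) (snd z)) \<partial>(lebesgue \<Otimes>\<^sub>M lebesgue))"
    by (subst lebesgue.nn_integral_fst[symmetric]) auto
  also have "\<dots> \<le> (\<integral>\<^sup>+ z. ennreal e * (indicator B (fst z) * ennreal (I (fst z) (snd z)))
      + ennreal e * (indicator B (snd z) * ennreal (I (fst z) (snd z))) + ennreal A * ennreal (gagliardo s p w z)
      \<partial>(lebesgue \<Otimes>\<^sub>M lebesgue))"
  proof (rule nn_integral_mono)
    fix z :: "'a \<times> 'a"
    obtain x y where z: "z = (x, y)" by fastforce
    have "ennreal (\<bar>w x - w y\<bar> * I x y)
        \<le> ennreal (e * indicator B x * I x y + e * indicator B y * I x y + A * gagliardo s p w (x, y))"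
      by (rule ennreal_leI[OF pw])
    also have "\<dots> = ennreal e * (indicator B x * ennreal (I x y))
      + ennreal e * (indicator B y * ennreal (I x y)) + ennreal A * ennreal (gagliardo s p w (x, y))"
      using e \<open>0 \<le> A\<close> by (simp add: ennreal_plus ennreal_mult ennreal_indicator mult.assoc)
    finally show "ennreal (\<bar>w (fst z) - w (snd z)\<bar> * I (fst z) (snd z))
        \<le> ennreal e * (indicator B (fst z) * ennreal (I (fst z) (snd z)))
      + ennreal e * (indicator B (snd z) * ennreal (I (fst z) (snd z))) + ennreal A * ennreal (gagliardo s p w z)"
      by (simp add: z)
  qed
  also have "\<dots> = ennreal e * (\<integral>\<^sup>+ z. indicator B (fst z) * ennreal (I (fst z) (snd z)) \<partial>(lebesgue \<Otimes>\<^sub>M lebesgue))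
      + ennreal e * (\<integral>\<^sup>+ z. indicator B (snd z) * ennreal (I (fst z) (snd z)) \<partial>(lebesgue \<Otimes>\<^sub>M lebesgue))
      + ennreal A * seminorm_pow s p w"
    by (simp add: nn_integral_add nn_integral_cmult seminorm_pow_eq)
  also have "(\<integral>\<^sup>+ z. indicator B (fst z) * ennreal (I (fst z) (snd z)) \<partial>(lebesgue \<Otimes>\<^sub>M lebesgue)) = emeasure lebesgue B"
    by (subst lebesgue.nn_integral_fst[symmetric]) (auto simp: nn_integral_cmult I_nn)
  \<comment> \<open>Here the inner integral runs over the first variable; symmetry of the kernel
    gives it mass 1 there too.\<close>
  also have "(\<integral>\<^sup>+ z. indicator B (snd z) * ennreal (I (fst z) (snd z)) \<partial>(lebesgue \<Otimes>\<^sub>M lebesgue)) = emeasure lebesgue B"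
    by (subst lebesgue_pair.nn_integral_snd[symmetric]) (auto simp: nn_integral_cmult I_nn I_sym[of _ "_ :: 'a"])
  also have "ennreal e * emeasure lebesgue B + ennreal e * emeasure lebesgue B = ennreal (2 * e) * emeasure lebesgue B"
    unfolding distrib_right[symmetric] using e by (simp add: ennreal_plus[symmetric] del: ennreal_plus)
  finally show ?thesis unfolding A_def q_def .
qed

subsection \<open>Compactness\<close>

text \<open>Dominated convergence: the bound by a multiple of the indicator of \<open>B\<close>
  passes to the limit, and twice this bound dominates the differences.\<close>

lemma integral_tendsto_zero_bounded_support:
  fixes f :: "nat \<Rightarrow> 'a \<Rightarrow> real"
  assumes "\<And>k. f k \<in> borel_measurable M" "B \<in> sets M" "emeasure M B < \<infinity>"
    and "\<And>x. (\<lambda>k. f k x) \<longlonglongrightarrow> f' x" "\<And>k x. \<bar>f k x\<bar> \<le> c * indicator B x"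
  shows "integrable M f'" "\<And>k. integrable M (f k)" "(\<lambda>k. \<integral>x. \<bar>f k x - f' x\<bar> \<partial>M) \<longlonglongrightarrow> 0"
proof -
  have [measurable]: "\<And>k. f k \<in> borel_measurable M" "f' \<in> borel_measurable M"
    using assms borel_measurable_LIMSEQ_real[of M f f'] by auto
  have lim: "\<bar>f' x\<bar> \<le> c * indicator B x" for x
    by (rule LIMSEQ_le_const2[OF tendsto_rabs[OF assms(4)]]) (use assms(5) in auto)
  have c: "integrable M (\<lambda>x. c * indicator B x :: real)"
    using assms by (intro integrable_mult_right integrable_real_indicator) auto
  show "integrable M f'" "\<And>k. integrable M (f k)"
    using lim assms(5)
    by (auto intro!: Bochner_Integration.integrable_bound[OF c] AE_I2 order_trans[OF _ abs_ge_self])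
  have "(\<lambda>k. \<integral>x. \<bar>f k x - f' x\<bar> \<partial>M) \<longlonglongrightarrow> (\<integral>x. 0 \<partial>M)"
  proof (rule integral_dominated_convergence[where w = "\<lambda>x. 2 * (c * indicator B x)"])
    show "AE x in M. (\<lambda>k. \<bar>f k x - f' x\<bar>) \<longlonglongrightarrow> 0"
      by (intro AE_I2 tendsto_rabs_zero LIM_zero assms(4))
    show "AE x in M. norm \<bar>f k x - f' x\<bar> \<le> 2 * (c * indicator B x)" for k
    proof (rule AE_I2)
      fix x show "norm \<bar>f k x - f' x\<bar> \<le> 2 * (c * indicator B x)"
        using lim[of x] assms(5)[of k x] by auto
    qed
  qed (use c in auto)
  then show "(\<lambda>k. \<integral>x. \<bar>f k x - f' x\<bar> \<partial>M) \<longlonglongrightarrow> 0" by simp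
qed

text \<open>The inequality \<open>le_add_powr_mult\<close> with \<open>e = 1\<close> bounds
  \<open>\<bar>w x\<bar>\<close> by \<open>\<bar>w x\<bar> powr p\<close> plus the indicator of
  \<open>B\<close>.\<close>

lemma integrable_of_powr:
  fixes w :: "'a \<Rightarrow> real"
  assumes "w \<in> borel_measurable M" "B \<in> sets M" "emeasure M B < \<infinity>" "1 \<le> p" "0 \<le> K"
    and "\<And>x. x \<notin> B \<Longrightarrow> w x = 0" "(\<integral>\<^sup>+ x. ennreal (\<bar>w x\<bar> powr p) \<partial>M) \<le> ennreal K"
  shows "integrable M w" "(\<integral>x. \<bar>w x\<bar> \<partial>M) \<le> measure M B + K"
proof -
  have [measurable]: "w \<in> borel_measurable M" "B \<in> sets M" using assms by auto
  have "\<bar>w x\<bar> \<le> indicator B x + \<bar>w x\<bar> powr p" for x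
    using le_add_powr_mult[of "\<bar>w x\<bar>" 1 p] assms by (cases "x \<in> B") auto
  then have "ennreal \<bar>w x\<bar> \<le> ennreal (indicator B x + \<bar>w x\<bar> powr p)" for x
    by (rule ennreal_leI)
  then have "ennreal \<bar>w x\<bar> \<le> indicator B x + ennreal (\<bar>w x\<bar> powr p)" for x
    by (simp add: ennreal_plus ennreal_indicator)
  then have "(\<integral>\<^sup>+ x. ennreal \<bar>w x\<bar> \<partial>M) \<le> (\<integral>\<^sup>+ x. indicator B x + ennreal (\<bar>w x\<bar> powr p) \<partial>M)"
    by (rule nn_integral_mono)
  also have "\<dots> = emeasure M B + (\<integral>\<^sup>+ x. ennreal (\<bar>w x\<bar> powr p) \<partial>M)"
    by (simp add: nn_integral_add)
  also have "\<dots> \<le> ennreal (measure M B) + ennreal K"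
    using assms by (intro add_mono) (auto simp: emeasure_eq_ennreal_measure)
  also have "\<dots> = ennreal (measure M B + K)" using assms by (simp add: ennreal_plus)
  finally have *: "(\<integral>\<^sup>+ x. ennreal \<bar>w x\<bar> \<partial>M) \<le> ennreal (measure M B + K)" .
  then have "(\<integral>\<^sup>+ x. ennreal (norm (w x)) \<partial>M) < \<infinity>"
    by (simp add: le_less_trans[OF _ ennreal_less_top])
  then show i: "integrable M w" by (simp add: integrable_iff_bounded)
  show "(\<integral>x. \<bar>w x\<bar> \<partial>M) \<le> measure M B + K"
    using * i assms(5) by (simp add: nn_integral_eq_integral ennreal_le_iff del: ennreal_plus)
qed

text \<open>The subsequence \<open>r0\<close> is fixed before any tolerance and makes the averages
  converge on every mesh at once. A fine mesh then controls the averaging error uniformly in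
  \<open>k\<close>, so this subsequence is Cauchy in \<open>L\<^sup>1\<close>, and a further one
  converges almost everywhere.\<close>

theorem Wsp_bounded_support_compact:
  fixes v :: "nat \<Rightarrow> 'a::euclidean_space \<Rightarrow> real"
  assumes \<Omega>: "bounded \<Omega>" and p: "1 \<le> p" and s: "0 < s"
    and v [measurable]: "\<And>k. v k \<in> borel_measurable lebesgue"
    and v0: "\<And>k x. x \<notin> \<Omega> \<Longrightarrow> v k x = 0"
    and C: "\<And>k. seminorm_pow s p (v k) \<le> ennreal C"
  obtains r :: "nat \<Rightarrow> nat" where "strict_mono r" "AE x in lebesgue. convergent (\<lambda>k. v (r k) x)"
proof -
  obtain R where R: "0 < R" "\<And>x. x \<in> \<Omega> \<Longrightarrow> norm x \<le> R"
    using \<Omega> bounded_pos by blast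
  let ?n = "DIM('a)"
  define B where "B t = (cball 0 (R + t) :: 'a set)" for t
  have B [measurable]: "B t \<in> sets lebesgue" "emeasure lebesgue (B t) < \<infinity>" for t
    using emeasure_bounded_finite[OF bounded_cball] by (auto simp: B_def)
  have vB: "v k x = 0" if "x \<notin> B t" "0 \<le> t" for k x t
    using that R(2)[of x] by (intro v0) (auto simp: B_def)
  obtain P where P: "0 \<le> P" "\<And>v. v \<in> borel_measurable lebesgue \<Longrightarrow> (\<And>x. x \<notin> \<Omega> \<Longrightarrow> v x = 0) \<Longrightarrow>
      (\<integral>\<^sup>+ x. ennreal (\<bar>v x\<bar> powr p) \<partial>lebesgue) \<le> ennreal P * seminorm_pow s p v"
    using poincare_bounded_support[OF \<Omega>, of s p] p s by auto
  \<comment> \<open>\<open>C\<close> may be negative, in which case \<open>ennreal C\<close> is 0;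
    \<open>max C 0\<close> gives the same bound with a nonnegative real.\<close>
  define K where "K = P * max C 0"
  have "0 \<le> K" using P(1) by (simp add: K_def)
  have C': "seminorm_pow s p (v k) \<le> ennreal (max C 0)" for k
    using C[of k] by (auto simp: max_def ennreal_neg split: if_splits)
  have LpK: "(\<integral>\<^sup>+ x. ennreal (\<bar>v k x\<bar> powr p) \<partial>lebesgue) \<le> ennreal K" for k
    using order_trans[OF P(2)[OF v v0] mult_left_mono[OF C']] P(1)
    by (simp add: K_def ennreal_mult)
  define L where "L = measure lebesgue (B 0) + K"
  have v_int: "integrable lebesgue (v k)" and v_L: "(\<integral>x. \<bar>v k x\<bar> \<partial>lebesgue) \<le> L" for k
    using integrable_of_powr[OF v B(1)[of 0] B(2)[of 0] p \<open>0 \<le> K\<close> _ LpK, of k] vB[of _ 0]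
    by (auto simp: L_def)
  have "0 \<le> L" using \<open>0 \<le> K\<close> by (simp add: L_def)

  define hh where "hh m = 1 / real (Suc m)" for m
  have hh: "0 < hh m" for m by (simp add: hh_def)
  \<comment> \<open>\<open>S\<close> lists all cells of all meshes, as pairs of a mesh index and a
    corner; \<open>F k\<close> is the integral of \<open>v k\<close> over such a cell.\<close>
  define S where "S = (SIGMA m:UNIV. range (corner (hh m) :: 'a \<Rightarrow> 'a))"
  define F where "F k z = (\<integral>y. v k y * indicator {y. corner (hh (fst z)) y = snd z} y \<partial>lebesgue)" for k z
  have vF_int: "integrable lebesgue (\<lambda>y. v k y * indicator {y. corner h y = a} y)" for k h a
    using v_int by (rule integrable_real_mult_indicator[OF corner_fibre_sets])
  have F_bound: "\<bar>F k z\<bar> \<le> L" for k z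
  proof -
    have "\<bar>F k z\<bar> \<le> (\<integral>y. \<bar>v k y * indicator {y. corner (hh (fst z)) y = snd z} y\<bar> \<partial>lebesgue)"
      unfolding F_def by (rule integral_abs_bound)
    also have "\<dots> \<le> (\<integral>y. \<bar>v k y\<bar> \<partial>lebesgue)"
      using vF_int v_int by (intro integral_mono) (auto simp: indicator_def)
    finally show ?thesis using v_L[of k] by simp
  qed
  have "countable S" unfolding S_def by (intro countable_SIGMA countable_range_corner) auto
  \<comment> \<open>Diagonal extraction over the countable set \<open>S\<close>; every
    \<open>F k z\<close> is bounded by \<open>L\<close>.\<close>
  then obtain r0 :: "nat \<Rightarrow> nat" where r0: "strict_mono r0" "\<And>z. z \<in> S \<Longrightarrow> \<exists>l. (\<lambda>k. F (r0 k) z) \<longlonglongrightarrow> l"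
    using function_convergent_subsequence[of S F L] F_bound by auto
  define w where "w k = v (r0 k)" for k
  have w [measurable]: "w k \<in> borel_measurable lebesgue" for k by (simp add: w_def)
  have w_int: "integrable lebesgue (w k)" for k by (simp add: w_def v_int)
  have avg_eq: "cell_average (hh m) (w k) x = F (r0 k) (m, corner (hh m) x) / hh m ^ ?n" for m k x
    by (simp add: cell_average_def w_def F_def)
  have avg_lim: "convergent (\<lambda>k. cell_average (hh m) (w k) x)" for m x
  proof -
    obtain l where "(\<lambda>k. F (r0 k) (m, corner (hh m) x)) \<longlonglongrightarrow> l"
      using r0(2)[of "(m, corner (hh m) x)"] by (auto simp: S_def)
    then show ?thesis
      unfolding avg_eq using hh[of m] by (intro convergentI[OF tendsto_divide[OF _ tendsto_const]]) auto
  qed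
  \<comment> \<open>A cell that meets the support stays within the ball enlarged by the bound on the
    cell diameter, so averages vanish outside that ball.\<close>
  have avg_bound: "\<bar>cell_average (hh m) (w k) x\<bar> \<le> L / hh m ^ ?n * indicator (B (real ?n * hh m)) x" for m k x
  proof (cases "x \<in> B (real ?n * hh m)")
    case True
    then show ?thesis using F_bound[of "r0 k"] hh[of m] by (simp add: avg_eq divide_right_mono)
  next
    case False
    have z: "w k y * indicator {y. corner (hh m) y = corner (hh m) x} y = 0" for y
    proof (cases "corner (hh m) y = corner (hh m) x")
      case True
      from norm_diff_le_if_corner_eq[OF hh this] False have "y \<notin> B 0"
        using norm_triangle_ineq[of "x - y" y] by (auto simp: B_def norm_minus_commute)
      then show ?thesis using vB[of y 0] by (simp add: w_def)
    qed auto
    show ?thesis using False by (simp only: cell_average_def z) simp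
  qed
  define Pw where "Pw m x = lim (\<lambda>k. cell_average (hh m) (w k) x)" for m x
  have avg_tendsto: "(\<lambda>k. cell_average (hh m) (w k) x) \<longlonglongrightarrow> Pw m x" for m x
    using avg_lim unfolding Pw_def by (simp add: convergent_LIMSEQ_iff)
  note Pw = integral_tendsto_zero_bounded_support[OF cell_average_measurable[OF w] B avg_tendsto avg_bound]

  have Cauchy: "\<exists>N. \<forall>i\<ge>N. \<forall>j\<ge>N. (LINT x|lebesgue. norm (w i x - w j x)) < e" if "0 < e" for e
  proof -
    \<comment> \<open>Chosen so that the first error term is at most \<open>e / 8\<close>; the
      summand 1 keeps the denominator positive.\<close>
    define \<epsilon> where "\<epsilon> = e / (16 * (measure lebesgue (B 0) + 1))"
    have \<epsilon>: "0 < \<epsilon>" "2 * \<epsilon> * measure lebesgue (B 0) \<le> e / 8"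
      using \<open>0 < e\<close> by (auto simp: \<epsilon>_def field_simps add_pos_nonneg)
    define A where "A m = \<epsilon> powr (1 - p) * (real ?n * hh m) powr (real ?n + s * p) / hh m ^ ?n" for m
    have A: "0 \<le> A m" for m using hh[of m] by (simp add: A_def)
    \<comment> \<open>The factor \<open>hh m ^ ?n\<close> cancels and leaves
      \<open>hh m powr (s * p)\<close>, which tends to 0 because \<open>s * p > 0\<close>.\<close>
    have A_eq: "A m = \<epsilon> powr (1 - p) * real ?n powr (real ?n + s * p) * hh m powr (s * p)" for m
      using hh[of m] by (simp add: A_def powr_mult powr_add powr_realpow)
    have "(\<lambda>m. hh m powr (s * p)) \<longlonglongrightarrow> 0"
    proof (rule tendsto_zero_powrI)
      show "hh \<longlonglongrightarrow> 0" unfolding hh_def by (rule LIMSEQ_Suc[OF lim_1_over_n])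
      show "(\<lambda>m. s * p) \<longlonglongrightarrow> s * p" by simp
      show "\<forall>\<^sub>F m in sequentially. 0 \<le> hh m" using hh by (simp add: less_imp_le)
    qed (use s p in auto)
    then have "(\<lambda>m. A m * max C 0) \<longlonglongrightarrow> 0"
      unfolding A_eq by (intro tendsto_mult_left_zero tendsto_mult_right_zero)
    then have "\<forall>\<^sub>F m in sequentially. A m * max C 0 < e / 8"
      using \<open>0 < e\<close> by (intro order_tendstoD(2)[where y = 0]) auto
    then obtain m where m: "A m * max C 0 < e / 8"
      by (auto simp: eventually_sequentially)
    \<comment> \<open>Uniform in \<open>k\<close>, since only the common support and the common
      seminorm bound enter.\<close>
    have err: "(\<integral>x. \<bar>w k x - cell_average (hh m) (w k) x\<bar> \<partial>lebesgue) < e / 4" for k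
    proof -
      have "(\<integral>\<^sup>+ x. ennreal \<bar>w k x - cell_average (hh m) (w k) x\<bar> \<partial>lebesgue)
          \<le> ennreal (2 * \<epsilon>) * emeasure lebesgue (B 0) + ennreal (A m) * seminorm_pow s p (w k)"
        unfolding A_def using hh \<epsilon>(1) p s w_int vB[of _ 0]
        by (intro cell_average_L1_error) (auto simp: w_def B)
      also have "\<dots> \<le> ennreal (2 * \<epsilon>) * ennreal (measure lebesgue (B 0)) + ennreal (A m) * ennreal (max C 0)"
        using B(2)[of 0] C' by (intro add_mono mult_left_mono) (auto simp: emeasure_eq_ennreal_measure w_def)
      also have "\<dots> = ennreal (2 * \<epsilon> * measure lebesgue (B 0) + A m * max C 0)"
        using \<epsilon>(1) A by (simp add: ennreal_plus ennreal_mult)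
      finally have "(\<integral>\<^sup>+ x. ennreal \<bar>w k x - cell_average (hh m) (w k) x\<bar> \<partial>lebesgue)
        \<le> ennreal (2 * \<epsilon> * measure lebesgue (B 0) + A m * max C 0)" .
      then have "(\<integral>x. \<bar>w k x - cell_average (hh m) (w k) x\<bar> \<partial>lebesgue) \<le> 2 * \<epsilon> * measure lebesgue (B 0) + A m * max C 0"
        using w_int Pw(2)[of m k] \<epsilon>(1) A[of m]
        by (simp add: nn_integral_eq_integral ennreal_le_iff del: ennreal_plus)
      then show ?thesis using \<epsilon>(2) m by linarith
    qed
    have "\<forall>\<^sub>F k in sequentially. (\<integral>x. \<bar>cell_average (hh m) (w k) x - Pw m x\<bar> \<partial>lebesgue) < e / 4"
      using \<open>0 < e\<close> by (intro order_tendstoD(2)[OF Pw(3)]) auto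
    then obtain N where N: "\<And>k. N \<le> k \<Longrightarrow> (\<integral>x. \<bar>cell_average (hh m) (w k) x - Pw m x\<bar> \<partial>lebesgue) < e / 4"
      by (auto simp: eventually_sequentially)
    have near: "(\<integral>x. \<bar>w k x - Pw m x\<bar> \<partial>lebesgue) < e / 2" if "N \<le> k" for k
    proof -
      have "(\<integral>x. \<bar>w k x - Pw m x\<bar> \<partial>lebesgue)
        \<le> (\<integral>x. \<bar>w k x - cell_average (hh m) (w k) x\<bar> + \<bar>cell_average (hh m) (w k) x - Pw m x\<bar> \<partial>lebesgue)"
        using w_int Pw(1,2) by (intro integral_mono) auto
      also have "\<dots> = (\<integral>x. \<bar>w k x - cell_average (hh m) (w k) x\<bar> \<partial>lebesgue)
          + (\<integral>x. \<bar>cell_average (hh m) (w k) x - Pw m x\<bar> \<partial>lebesgue)"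
        using w_int Pw(1,2) by (intro Bochner_Integration.integral_add) auto
      finally show ?thesis using err[of k] N[OF that] by linarith
    qed
    have "(LINT x|lebesgue. norm (w i x - w j x)) < e" if "N \<le> i" "N \<le> j" for i j
    proof -
      have "(LINT x|lebesgue. norm (w i x - w j x)) \<le> (\<integral>x. \<bar>w i x - Pw m x\<bar> + \<bar>w j x - Pw m x\<bar> \<partial>lebesgue)"
        using w_int Pw(1) by (intro integral_mono) auto
      also have "\<dots> = (\<integral>x. \<bar>w i x - Pw m x\<bar> \<partial>lebesgue) + (\<integral>x. \<bar>w j x - Pw m x\<bar> \<partial>lebesgue)"
        using w_int Pw(1) by (intro Bochner_Integration.integral_add) auto
      finally show ?thesis using near[OF that(1)] near[OF that(2)] by linarith
    qed
    then show ?thesis by blast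
  qed
  obtain r1 :: "nat \<Rightarrow> nat" where r1: "strict_mono r1" "AE x in lebesgue. Cauchy (\<lambda>i. w (r1 i) x)"
    using cauchy_L1_AE_cauchy_subseq[OF w_int Cauchy] by blast
  show ?thesis
  proof
    show "strict_mono (r0 \<circ> r1)" using r0(1) r1(1) by (rule strict_mono_o)
    show "AE x in lebesgue. convergent (\<lambda>k. v ((r0 \<circ> r1) k) x)"
      using r1(2) by (simp add: w_def Cauchy_convergent_iff)
  qed
qed

subsection \<open>Existence of minimizers\<close>

lemma ennreal_liminf_add:
  fixes f g :: "nat \<Rightarrow> ennreal"
  shows "liminf f + liminf g \<le> liminf (\<lambda>k. f k + g k)"
  including ennreal.lifting
proof transfer
  fix f g :: "nat \<Rightarrow> ereal"
  assume "pred_fun top ((\<le>) 0) f" "pred_fun top ((\<le>) 0) g"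
  then show "liminf f + liminf g \<le> liminf (\<lambda>k. f k + g k)"
    by (intro Liminf_add_le) auto
qed

text \<open>Fatou's lemma on pairs: at almost every pair the sequence converges at both points, and
  for \<open>p > 0\<close> the integrand depends continuously on the two values.\<close>

lemma seminorm_pow_le_liminf:
  fixes u :: "nat \<Rightarrow> 'a::euclidean_space \<Rightarrow> real"
  assumes [measurable]: "\<And>k. u k \<in> borel_measurable lebesgue"
    and lim: "AE x in lebesgue. (\<lambda>k. u k x) \<longlonglongrightarrow> u' x" and p: "0 < p"
  shows "seminorm_pow s p u' \<le> liminf (\<lambda>k. seminorm_pow s p (u k))"
proof -
  have "ennreal (gagliardo s p u' z) = liminf (\<lambda>k. ennreal (gagliardo s p (u k) z))"
    if "(\<lambda>k. u k (fst z)) \<longlonglongrightarrow> u' (fst z)" "(\<lambda>k. u k (snd z)) \<longlonglongrightarrow> u' (snd z)" for z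
  proof -
    have "(\<lambda>k. \<bar>u k (fst z) - u k (snd z)\<bar> powr p) \<longlonglongrightarrow> \<bar>u' (fst z) - u' (snd z)\<bar> powr p"
      using that p by (intro tendsto_powr' tendsto_rabs tendsto_diff tendsto_const) auto
    then have "(\<lambda>k. gagliardo s p (u k) z) \<longlonglongrightarrow> gagliardo s p u' z"
      unfolding gagliardo_def divide_inverse by (rule tendsto_mult_right)
    then have "(\<lambda>k. ennreal (gagliardo s p (u k) z)) \<longlonglongrightarrow> ennreal (gagliardo s p u' z)"
      by (rule tendsto_ennrealI)
    from lim_imp_Liminf[OF _ this] show ?thesis by simp
  qed
  then have "AE z in lebesgue \<Otimes>\<^sub>M lebesgue. ennreal (gagliardo s p u' z) = liminf (\<lambda>k. ennreal (gagliardo s p (u k) z))"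
    using AE_lebesgue_pairI[OF lim] by (auto elim!: AE_mp)
  then have "seminorm_pow s p u' = (\<integral>\<^sup>+ z. liminf (\<lambda>k. ennreal (gagliardo s p (u k) z)) \<partial>(lebesgue \<Otimes>\<^sub>M lebesgue))"
    unfolding seminorm_pow_eq by (rule nn_integral_cong_AE)
  also have "\<dots> \<le> liminf (\<lambda>k. seminorm_pow s p (u k))"
    unfolding seminorm_pow_eq by (rule nn_integral_liminf) measurable
  finally show ?thesis .
qed

text \<open>A positive limit forces eventually positive terms, so the indicator of the limit set is
  at most the lower limit of the indicators; Fatou's lemma concludes. The strict inequality in the
  set is essential.\<close>

lemma emeasure_positive_le_liminf:
  fixes u :: "nat \<Rightarrow> 'a \<Rightarrow> real"
  assumes [measurable]: "\<And>k. u k \<in> borel_measurable M" "u' \<in> borel_measurable M"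
    and \<Omega>: "\<Omega> \<in> sets M" and lim: "AE x in M. (\<lambda>k. u k x) \<longlonglongrightarrow> u' x"
  shows "emeasure M ({x. 0 < u' x} \<inter> \<Omega>) \<le> liminf (\<lambda>k. emeasure M ({x. 0 < u k x} \<inter> \<Omega>))"
proof -
  have meas: "{x. 0 < v x} \<inter> \<Omega> \<in> sets M" if [measurable]: "v \<in> borel_measurable M" for v :: "'a \<Rightarrow> real"
  proof -
    have "{x \<in> space M. 0 < v x} \<inter> \<Omega> \<in> sets M" using \<Omega> by measurable
    moreover have "{x \<in> space M. 0 < v x} \<inter> \<Omega> = {x. 0 < v x} \<inter> \<Omega>" using sets.sets_into_space[OF \<Omega>] by auto
    ultimately show ?thesis by simp
  qed
  have "indicator ({x. 0 < u' x} \<inter> \<Omega>) x \<le> liminf (\<lambda>k. indicator ({x. 0 < u k x} \<inter> \<Omega>) x :: ennreal)"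
    if "(\<lambda>k. u k x) \<longlonglongrightarrow> u' x" for x
  proof (cases "x \<in> {x. 0 < u' x} \<inter> \<Omega>")
    case True
    then have "\<forall>\<^sub>F k in sequentially. 0 < u k x" using order_tendstoD(1)[OF that] by auto
    then have "\<forall>\<^sub>F k in sequentially. (1 :: ennreal) \<le> indicator ({x. 0 < u k x} \<inter> \<Omega>) x"
      by eventually_elim (use True in auto)
    then show ?thesis using True by (simp add: Liminf_bounded)
  qed simp
  then have "AE x in M. indicator ({x. 0 < u' x} \<inter> \<Omega>) x \<le> liminf (\<lambda>k. indicator ({x. 0 < u k x} \<inter> \<Omega>) x :: ennreal)"
    using lim by (auto elim!: AE_mp)
  then have "(\<integral>\<^sup>+ x. indicator ({x. 0 < u' x} \<inter> \<Omega>) x \<partial>M) \<le> (\<integral>\<^sup>+ x. liminf (\<lambda>k. indicator ({x. 0 < u k x} \<inter> \<Omega>) x) \<partial>M)"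
    by (rule nn_integral_mono_AE)
  also have "\<dots> \<le> liminf (\<lambda>k. \<integral>\<^sup>+ x. indicator ({x. 0 < u k x} \<inter> \<Omega>) x \<partial>M)"
    by (rule nn_integral_liminf) (use meas in auto)
  finally show ?thesis using meas by simp
qed

lemma functional_le_liminf:
  fixes u :: "nat \<Rightarrow> 'a::euclidean_space \<Rightarrow> real"
  assumes "\<And>k. u k \<in> borel_measurable lebesgue" "u' \<in> borel_measurable lebesgue" "open \<Omega>" "0 < p"
    and "AE x in lebesgue. (\<lambda>k. u k x) \<longlonglongrightarrow> u' x"
  shows "functional s p \<Omega> M u' \<le> liminf (\<lambda>k. functional s p \<Omega> M (u k))"
proof -
  have "functional s p \<Omega> M u' \<le> liminf (\<lambda>k. seminorm_pow s p (u k))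
      + ennreal M * liminf (\<lambda>k. emeasure lebesgue ({x. 0 < u k x} \<inter> \<Omega>))"
    unfolding functional_def using assms
    by (intro add_mono mult_left_mono seminorm_pow_le_liminf emeasure_positive_le_liminf) auto
  \<comment> \<open>Multiplication by a finite constant is monotone and continuous, so it commutes
    with the lower limit.\<close>
  also have "ennreal M * liminf (\<lambda>k. emeasure lebesgue ({x. 0 < u k x} \<inter> \<Omega>))
      = liminf (\<lambda>k. ennreal M * emeasure lebesgue ({x. 0 < u k x} \<inter> \<Omega>))"
    by (rule Liminf_compose_continuous_mono[symmetric])
       (auto intro!: monoI mult_left_mono ennreal_continuous_on_cmult continuous_on_id)
  also have "liminf (\<lambda>k. seminorm_pow s p (u k)) + \<dots> \<le> liminf (\<lambda>k. functional s p \<Omega> M (u k))"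
    unfolding functional_def by (rule ennreal_liminf_add)
  finally show ?thesis .
qed

lemma functional_finite:
  assumes "u \<in> Wsp s p" "bounded \<Omega>" "open \<Omega>"
  shows "functional s p \<Omega> M u < \<infinity>"
proof -
  have "emeasure lebesgue ({x. u x > 0} \<inter> \<Omega>) \<le> emeasure lebesgue \<Omega>"
    using assms by (intro emeasure_mono) auto
  also have "\<dots> < \<infinity>" using assms emeasure_bounded_finite by (auto simp: less_top)
  finally show ?thesis using assms by (auto simp: functional_def Wsp_def ennreal_mult_less_top)
qed

theorem minimizer_exists:
  fixes g :: "'a::euclidean_space \<Rightarrow> real"
  assumes p: "1 \<le> p" and s: "0 < s" and \<Omega>: "open \<Omega>" "bounded \<Omega>" and g: "g \<in> Wsp s p"
  shows "\<exists>u. minimizer s p \<Omega> M g u"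
proof -
  let ?I = "functional s p \<Omega> M"
  have gA: "g \<in> admissible s p \<Omega> g" using g by (simp add: admissible_def)
  \<comment> \<open>A decreasing sequence of values, so that \<open>f 0\<close> bounds the seminorms
    of the whole minimizing sequence.\<close>
  obtain f :: "nat \<Rightarrow> ennreal" where f: "decseq f" "range f \<subseteq> ?I ` admissible s p \<Omega> g"
    "Inf (?I ` admissible s p \<Omega> g) = (INF i. f i)"
    using ennreal_Inf_countable_INF[of "?I ` admissible s p \<Omega> g"] gA by auto
  have "\<exists>v. v \<in> admissible s p \<Omega> g \<and> ?I v = f k" for k
    using range_subsetD[OF f(2), of k] by auto
  then obtain u where u: "\<And>k. u k \<in> admissible s p \<Omega> g" "\<And>k. ?I (u k) = f k" by metis
  have f_lim: "f \<longlonglongrightarrow> Inf (?I ` admissible s p \<Omega> g)"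
    unfolding f(3) by (rule LIMSEQ_INF[OF f(1)])
  have uW: "u k \<in> Wsp s p" for k using u(1) by (simp add: admissible_def)
  have [measurable]: "u k \<in> borel_measurable lebesgue" "g \<in> borel_measurable lebesgue" for k
    using uW g by (auto dest: Wsp_measurable)
  have [measurable]: "\<Omega> \<in> sets lebesgue" using \<Omega> by auto

  \<comment> \<open>The indicator makes the difference vanish off \<open>\<Omega>\<close> at every
    point, as the compactness and Poincare bounds require, and not only almost everywhere.\<close>
  define v where "v k x = indicator \<Omega> x * (u k x - g x)" for k x
  have v_meas [measurable]: "v k \<in> borel_measurable lebesgue" for k
    unfolding v_def by measurable
  have v_AE: "AE x in lebesgue. v k x = u k x - g x" for k
    using u(1)[of k] by (auto simp: admissible_def v_def indicator_def elim!: AE_mp)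
  have vW: "v k \<in> Wsp s p" for k
    by (rule Wsp_cong_AE[OF Wsp_diff[OF uW g] v_meas v_AE]) (use p in simp)
  have "seminorm_pow s p (v k) \<le> ennreal (2 powr p) * (f 0 + ennreal (\<bar>-1\<bar> powr p) * seminorm_pow s p g)" for k
  proof -
    have "seminorm_pow s p (v k) = seminorm_pow s p (\<lambda>x. u k x + (-1) * g x)"
      using v_AE[of k] by (intro seminorm_pow_cong_AE) auto
    also have "\<dots> \<le> ennreal (2 powr p) * (seminorm_pow s p (u k) + seminorm_pow s p (\<lambda>x. (-1) * g x))"
      using p by (intro seminorm_pow_add_le) auto
    also have "\<dots> \<le> ennreal (2 powr p) * (f 0 + seminorm_pow s p (\<lambda>x. (-1) * g x))"
    proof (intro mult_left_mono add_right_mono)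
      have "seminorm_pow s p (u k) \<le> f k"
        unfolding u(2)[symmetric] functional_def by simp
      also have "\<dots> \<le> f 0" using f(1) by (simp add: decseq_def)
      finally show "seminorm_pow s p (u k) \<le> f 0" .
    qed simp
    also have "seminorm_pow s p (\<lambda>x. (-1) * g x) = ennreal (\<bar>-1\<bar> powr p) * seminorm_pow s p g"
      by (rule seminorm_pow_cmult) measurable
    finally show ?thesis .
  qed
  moreover have "ennreal (2 powr p) * (f 0 + ennreal (\<bar>-1\<bar> powr p) * seminorm_pow s p g) < \<infinity>"
    using functional_finite[OF uW[of 0] \<Omega>(2,1), of M] g u(2)[of 0]
    by (auto simp: Wsp_def ennreal_mult_less_top)
  ultimately obtain C where C: "0 \<le> C" "\<And>k. seminorm_pow s p (v k) \<le> ennreal C"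
    by (metis ennreal_cases infinity_ennreal_def less_irrefl)
  have v0: "v k x = 0" if "x \<notin> \<Omega>" for k x using that by (simp add: v_def)
  obtain r :: "nat \<Rightarrow> nat" where r: "strict_mono r" "AE x in lebesgue. convergent (\<lambda>k. v (r k) x)"
    by (rule Wsp_bounded_support_compact[OF \<Omega>(2) p s v_meas v0 C(2)])

  \<comment> \<open>Where the sequence diverges \<open>lim\<close> is unspecified, which affects
    only a null set; off \<open>\<Omega>\<close> the sequence is constantly 0, and so is
    \<open>v'\<close>.\<close>
  define v' where "v' x = lim (\<lambda>k. v (r k) x)" for x
  have v'_meas [measurable]: "v' \<in> borel_measurable lebesgue"
    unfolding v'_def by (rule borel_measurable_lim_metric) measurable
  have v'_lim: "AE x in lebesgue. (\<lambda>k. v (r k) x) \<longlonglongrightarrow> v' x"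
    using r(2) by (simp add: v'_def convergent_LIMSEQ_iff)
  have v'0: "v' x = 0" if "x \<notin> \<Omega>" for x using that by (simp add: v'_def v0)
  obtain P where P: "0 \<le> P" "\<And>v. v \<in> borel_measurable lebesgue \<Longrightarrow> (\<And>x. x \<notin> \<Omega> \<Longrightarrow> v x = 0) \<Longrightarrow>
      (\<integral>\<^sup>+ x. ennreal (\<bar>v x\<bar> powr p) \<partial>lebesgue) \<le> ennreal P * seminorm_pow s p v"
    using poincare_bounded_support[OF \<Omega>(2), of s p] p s by auto
  have "seminorm_pow s p v' \<le> liminf (\<lambda>k. seminorm_pow s p (v (r k)))"
    using p by (intro seminorm_pow_le_liminf v'_lim) auto
  also have "\<dots> \<le> liminf (\<lambda>k. ennreal C)"
    using C(2) by (intro Liminf_mono) auto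
  finally have "seminorm_pow s p v' \<le> ennreal C" by (simp add: Liminf_const)
  then have sv': "seminorm_pow s p v' < \<infinity>" by (simp add: le_less_trans[OF _ ennreal_less_top])
  \<comment> \<open>The bound on the seminorm yields membership in \<open>Lp\<close> through the
    Poincare inequality.\<close>
  have "(\<integral>\<^sup>+ x. ennreal (\<bar>v' x\<bar> powr p) \<partial>lebesgue) \<le> ennreal P * seminorm_pow s p v'"
    by (rule P(2)[OF v'_meas v'0])
  also have "\<dots> < \<infinity>" using sv' by (simp add: ennreal_mult_less_top)
  finally have v'W: "v' \<in> Wsp s p" using sv' by (simp add: Wsp_iff_nn_integral)

  define u' where "u' x = g x + v' x" for x
  have u'A: "u' \<in> admissible s p \<Omega> g"
    using Wsp_add[OF g v'W] p by (auto simp: admissible_def u'_def[abs_def] v'0)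
  have [measurable]: "u' \<in> borel_measurable lebesgue" unfolding u'_def by measurable
  have "AE x in lebesgue. \<forall>k. v k x = u k x - g x" using v_AE by (simp add: AE_all_countable)
  with v'_lim have u'_lim: "AE x in lebesgue. (\<lambda>k. u (r k) x) \<longlonglongrightarrow> u' x"
  proof eventually_elim
    case (elim x)
    then have "(\<lambda>k. g x + v (r k) x) \<longlonglongrightarrow> u' x" unfolding u'_def by (intro tendsto_intros)
    then show ?case using elim by simp
  qed
  have "?I u' \<le> liminf (\<lambda>k. ?I (u (r k)))"
    using p \<Omega> by (intro functional_le_liminf u'_lim) auto
  \<comment> \<open>The whole sequence of values converges to the infimum, hence so does the
    subsequence along \<open>r\<close>.\<close>
  also have "\<dots> = Inf (?I ` admissible s p \<Omega> g)"
    unfolding u(2) using LIMSEQ_subseq_LIMSEQ[OF f_lim r(1)]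
    by (intro lim_imp_Liminf) (auto simp: o_def)
  finally have "?I u' \<le> ?I v" if "v \<in> admissible s p \<Omega> g" for v
    using that by (meson INF_lower order_trans)
  then show ?thesis using u'A by (auto simp: minimizer_def)
qed

subsection \<open>Properties of minimizers\<close>

text \<open>The positive part is a 1-Lipschitz function of the value and fixes 0, so neither
  integral increases.\<close>

lemma Wsp_pos_part:
  assumes "u \<in> Wsp s p" "0 \<le> p"
  shows "(\<lambda>x. max 0 (u x)) \<in> Wsp s p"
proof -
  have [measurable]: "u \<in> borel_measurable lebesgue" using assms by (simp add: Wsp_measurable)
  have "(\<integral>\<^sup>+ x. ennreal (\<bar>max 0 (u x)\<bar> powr p) \<partial>lebesgue) \<le> (\<integral>\<^sup>+ x. ennreal (\<bar>u x\<bar> powr p) \<partial>lebesgue)"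
    using assms(2) by (intro nn_integral_mono ennreal_leI powr_mono2) auto
  moreover have "seminorm_pow s p (\<lambda>x. max 0 (u x)) \<le> seminorm_pow s p u"
    unfolding seminorm_pow_eq gagliardo_def using assms(2)
    by (intro nn_integral_mono ennreal_leI divide_right_mono powr_mono2) auto
  ultimately show ?thesis
    using assms(1) by (auto simp: Wsp_iff_nn_integral intro: le_less_trans)
qed

text \<open>Both integrals agree and are finite, so the nonnegative function \<open>h - f\<close>
  has integral 0.\<close>

lemma AE_le_of_nn_integral_le:
  fixes f h :: "'a \<Rightarrow> ennreal"
  assumes [measurable]: "f \<in> borel_measurable M" "h \<in> borel_measurable M"
    and "\<And>x. f x \<le> h x" "integral\<^sup>N M h \<le> integral\<^sup>N M f" "integral\<^sup>N M h < \<infinity>"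
  shows "AE x in M. h x \<le> f x"
proof -
  have "integral\<^sup>N M f < \<infinity>" using nn_integral_mono[of M f h] assms(3,5) le_less_trans by blast
  then have "(\<integral>\<^sup>+ x. h x - f x \<partial>M) = integral\<^sup>N M h - integral\<^sup>N M f"
    using assms by (intro nn_integral_diff) auto
  also have "\<dots> = 0" using assms(4,5) by (simp add: diff_eq_0_iff_ennreal)
  finally have "AE x in M. h x - f x = 0" by (subst (asm) nn_integral_0_iff_AE) auto
  then show ?thesis
  proof eventually_elim
    case (elim x)
    show ?case using diff_add_cancel_ennreal[OF assms(3)[of x]] unfolding elim by simp
  qed
qed

text \<open>Almost everywhere, \<open>v x > 0\<close> implies \<open>u x > 0\<close>, so the measure
  term of \<open>v\<close> is no larger. It is finite for \<open>u\<close>, as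
  \<open>\<Omega>\<close> is bounded, and can be cancelled.\<close>

lemma functional_le_imp_seminorm_le:
  assumes "functional s p \<Omega> M u \<le> functional s p \<Omega> M v"
    and "AE x in lebesgue. v x \<le> u x \<or> v x \<le> 0"
    and [measurable]: "u \<in> borel_measurable lebesgue" "v \<in> borel_measurable lebesgue"
    and \<Omega>: "open \<Omega>" "bounded \<Omega>"
  shows "seminorm_pow s p u \<le> seminorm_pow s p v"
proof -
  have [measurable]: "\<Omega> \<in> sets lebesgue" using \<Omega> by auto
  let ?m = "ennreal M * emeasure lebesgue ({x. u x > 0} \<inter> \<Omega>)"
  have "emeasure lebesgue ({x. v x > 0} \<inter> \<Omega>) \<le> emeasure lebesgue ({x. u x > 0} \<inter> \<Omega>)"
    using assms(2) by (intro emeasure_mono_AE) auto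
  then have "functional s p \<Omega> M v \<le> seminorm_pow s p v + ?m"
    unfolding functional_def by (intro add_left_mono mult_left_mono) auto
  from order_trans[OF assms(1) this] have "?m + seminorm_pow s p u \<le> ?m + seminorm_pow s p v"
    by (simp only: functional_def add.commute)
  moreover have "?m \<noteq> top"
  proof -
    have "emeasure lebesgue ({x. u x > 0} \<inter> \<Omega>) \<le> emeasure lebesgue \<Omega>" by (intro emeasure_mono) auto
    also have "\<dots> < \<infinity>" using \<Omega> emeasure_bounded_finite by (auto simp: less_top)
    finally show ?thesis by (simp add: ennreal_mult_eq_top_iff)
  qed
  ultimately show ?thesis by (simp add: ennreal_add_left_cancel_le)
qed

lemma not_AE_mem_bounded:
  fixes \<Omega> :: "'a::euclidean_space set"
  assumes "bounded \<Omega>" "\<Omega> \<in> sets lebesgue"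
  shows "\<not> (AE x in lebesgue. x \<in> \<Omega>)"
proof
  assume "AE x in lebesgue. x \<in> \<Omega>"
  then have "emeasure lebesgue (UNIV :: 'a set) \<le> emeasure lebesgue \<Omega>"
    using assms(2) by (intro emeasure_mono_AE) auto
  then have "emeasure lebesgue \<Omega> = \<infinity>" by (simp add: top_unique)
  moreover obtain R where "\<And>x. x \<in> \<Omega> \<Longrightarrow> norm x \<le> R" using assms(1) bounded_pos by blast
  then have "emeasure lebesgue \<Omega> \<le> emeasure lebesgue (cball (0 :: 'a) R)"
    by (intro emeasure_mono) auto
  moreover have "emeasure lebesgue (cball (0 :: 'a) R) < \<infinity>"
    using emeasure_bounded_finite[OF bounded_cball] by auto
  ultimately show False by (metis leD)
qed

theorem minimizer_nonneg:
  fixes u g :: "'a::euclidean_space \<Rightarrow> real"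
  assumes min: "minimizer s p \<Omega> M g u" and p: "0 < p" and \<Omega>: "open \<Omega>" "bounded \<Omega>"
    and g: "AE x in lebesgue. x \<notin> \<Omega> \<longrightarrow> g x \<ge> 0"
  shows "AE x in lebesgue. u x \<ge> 0"
proof -
  define w where "w x = max 0 (u x)" for x
  have uA: "u \<in> admissible s p \<Omega> g" using min by (simp add: minimizer_def)
  then have uW: "u \<in> Wsp s p" and u_eq: "AE x in lebesgue. x \<notin> \<Omega> \<longrightarrow> u x = g x"
    by (auto simp: admissible_def)
  have u_off: "AE x in lebesgue. x \<notin> \<Omega> \<longrightarrow> 0 \<le> u x"
    using u_eq g by eventually_elim auto
  have wW: "w \<in> Wsp s p" using Wsp_pos_part[OF uW] p by (simp add: w_def[abs_def])
  have [measurable]: "u \<in> borel_measurable lebesgue" "w \<in> borel_measurable lebesgue"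
    using uW wW by (auto simp: Wsp_measurable)
  \<comment> \<open>The sign of \<open>g\<close> off \<open>\<Omega>\<close> makes the positive part
    of \<open>u\<close> admissible.\<close>
  have "AE x in lebesgue. x \<notin> \<Omega> \<longrightarrow> w x = g x"
    using u_eq g by eventually_elim (auto simp: w_def)
  with wW have "w \<in> admissible s p \<Omega> g" by (simp add: admissible_def)
  then have "functional s p \<Omega> M u \<le> functional s p \<Omega> M w" using min by (simp add: minimizer_def)
  then have le: "seminorm_pow s p u \<le> seminorm_pow s p w"
    by (rule functional_le_imp_seminorm_le) (use \<Omega> in \<open>auto simp: w_def\<close>)
  have "gagliardo s p w z \<le> gagliardo s p u z" for z
    unfolding gagliardo_def w_def using p by (intro divide_right_mono powr_mono2) auto
  then have "AE z in lebesgue \<Otimes>\<^sub>M lebesgue. ennreal (gagliardo s p u z) \<le> ennreal (gagliardo s p w z)"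
    using le uW unfolding seminorm_pow_eq Wsp_iff_nn_integral
    by (intro AE_le_of_nn_integral_le) (auto intro: ennreal_leI)
  then have "AE z in lebesgue \<Otimes>\<^sub>M lebesgue. \<not> (u (fst z) < 0 \<and> 0 \<le> u (snd z))"
  proof eventually_elim
    case (elim z)
    show ?case
    proof
      assume z: "u (fst z) < 0 \<and> 0 \<le> u (snd z)"
      then have "fst z \<noteq> snd z" by auto
      then have "0 < norm (fst z - snd z) powr (real DIM('a) + s * p)" by simp
      \<comment> \<open>The left difference is \<open>u (snd z)\<close>, the right one is
        \<open>u (snd z) - u (fst z)\<close> with \<open>u (fst z) < 0\<close>.\<close>
      moreover have "\<bar>w (fst z) - w (snd z)\<bar> powr p < \<bar>u (fst z) - u (snd z)\<bar> powr p"
        using z p by (intro powr_less_mono2) (auto simp: w_def)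
      ultimately have "gagliardo s p w z < gagliardo s p u z"
        unfolding gagliardo_def by (intro divide_strict_right_mono)
      then show False using elim by (simp add: ennreal_le_iff)
    qed
  qed
  \<comment> \<open>For almost every \<open>x\<close> with \<open>u x < 0\<close>, almost every
    \<open>y\<close> has \<open>u y < 0\<close> and hence lies in \<open>\<Omega>\<close>, which is
    impossible for a set of finite measure.\<close>
  from lebesgue_pair.AE_pair[OF this] show ?thesis
  proof eventually_elim
    case (elim x)
    show ?case
    proof (rule ccontr)
      assume "\<not> 0 \<le> u x"
      with elim have "AE y in lebesgue. u y < 0" by auto
      with u_off have "AE y in lebesgue. y \<in> \<Omega>" by eventually_elim auto
      then show False using not_AE_mem_bounded[OF \<Omega>(2)] \<Omega>(1) by auto
    qed
  qed
qed

section \<open>The function \<open>jp\<close> and the convexity of the \<open>p\<close>-th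
  power\<close>

lemma abs_jp: "\<bar>jp p x\<bar> = \<bar>x\<bar> powr (p - 1)"
proof (cases "x = 0")
  case False
  then have "\<bar>x\<bar> powr (p - 2) * \<bar>x\<bar> powr 1 = \<bar>x\<bar> powr (p - 1)"
    by (subst powr_add[symmetric]) simp
  then show ?thesis using False by (simp add: jp_def abs_mult)
qed (simp add: jp_def)

lemma jp_mult_self: "jp p x * x = \<bar>x\<bar> powr p"
proof (cases "x = 0")
  case False
  then have "\<bar>x\<bar> powr p = \<bar>x\<bar> powr (p - 2) * \<bar>x\<bar> powr 2"
    by (subst powr_add[symmetric]) simp
  then show ?thesis using False by (simp add: jp_def power2_eq_square)
qed simp

lemma jp_measurable [measurable]: "jp p \<in> borel_measurable borel"
  unfolding jp_def by measurable

text \<open>At 0 the factor \<open>\<bar>t\<bar> powr (p - 2)\<close> may be singular, so continuity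
  there is read off from \<open>\<bar>t\<bar> powr (p - 1)\<close>, the absolute value of
  \<open>jp p t\<close>.\<close>

lemma isCont_jp:
  assumes "1 < p"
  shows "isCont (jp p) a"
proof (cases "a = 0")
  case True
  have "((\<lambda>x. \<bar>x :: real\<bar> powr (p - 1)) \<longlongrightarrow> \<bar>0\<bar> powr (p - 1)) (at 0)"
    using assms by (intro tendsto_powr' tendsto_intros) auto
  then have "((\<lambda>x. \<bar>jp p x\<bar>) \<longlongrightarrow> 0) (at 0)" by (simp add: abs_jp)
  then have "(jp p \<longlongrightarrow> 0) (at 0)" by (rule tendsto_rabs_zero_cancel)
  then show ?thesis using True by (simp add: isCont_def jp_def)
next
  case False
  then show ?thesis unfolding jp_def by (intro continuous_intros) auto
qed

text \<open>The tangent inequality of a convex function, with slope \<open>p * jp p c\<close> at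
  \<open>c\<close>. It follows from Young's inequality with \<open>p\<close> and its conjugate
  exponent \<open>q\<close>.\<close>

lemma abs_powr_tangent_le:
  fixes a c p :: real
  assumes "1 < p"
  shows "\<bar>c\<bar> powr p + p * (jp p c * (a - c)) \<le> \<bar>a\<bar> powr p"
proof -
  define q where "q = p / (p - 1)"
  have q: "1 < q" "1 / p + 1 / q = 1" "(p - 1) * q = p" "p / q = p - 1"
    using assms by (auto simp: q_def field_simps)
  have "jp p c * a \<le> \<bar>a\<bar> * \<bar>c\<bar> powr (p - 1)"
    by (metis abs_ge_self abs_jp abs_mult mult.commute)
  also have "\<dots> \<le> \<bar>a\<bar> powr p / p + (\<bar>c\<bar> powr (p - 1)) powr q / q"
    using assms q by (intro Youngs_inequality) auto
  also have "(\<bar>c\<bar> powr (p - 1)) powr q = \<bar>c\<bar> powr p"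
    by (simp add: powr_powr q)
  finally have "p * (jp p c * a) \<le> p * (\<bar>a\<bar> powr p / p + \<bar>c\<bar> powr p / q)"
    using assms by (intro mult_left_mono) auto
  also have "\<dots> = \<bar>a\<bar> powr p + p / q * \<bar>c\<bar> powr p"
    using assms by (simp add: distrib_left)
  finally have "p * (jp p c * a) \<le> \<bar>a\<bar> powr p + (p - 1) * \<bar>c\<bar> powr p" by (simp add: q)
  moreover have "p * (jp p c * (a - c)) = p * (jp p c * a) - p * \<bar>c\<bar> powr p"
    by (simp add: right_diff_distrib jp_mult_self)
  ultimately show ?thesis by (simp add: left_diff_distrib)
qed

text \<open>Both \<open>\<bar>a - t * b\<bar>\<close> and \<open>\<bar>b\<bar>\<close> are at most
  \<open>\<bar>a\<bar> + \<bar>b\<bar>\<close>. The bound is uniform in \<open>t\<close> and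
  supplies the majorant for dominated convergence.\<close>

lemma abs_jp_mult_le:
  fixes a b t p :: real
  assumes "1 \<le> p" "0 \<le> t" "t \<le> 1"
  shows "\<bar>jp p (a - t * b) * b\<bar> \<le> 2 powr p * (\<bar>a\<bar> powr p + \<bar>b\<bar> powr p)"
proof (cases "\<bar>a\<bar> + \<bar>b\<bar> = 0")
  case False
  have "\<bar>t * b\<bar> \<le> \<bar>b\<bar>" using assms by (simp add: abs_mult mult_left_le_one_le)
  then have "\<bar>a - t * b\<bar> \<le> \<bar>a\<bar> + \<bar>b\<bar>" by linarith
  then have "\<bar>jp p (a - t * b) * b\<bar> \<le> (\<bar>a\<bar> + \<bar>b\<bar>) powr (p - 1) * (\<bar>a\<bar> + \<bar>b\<bar>) powr 1"
    unfolding abs_mult abs_jp using assms by (intro mult_mono powr_mono2) auto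
  also have "\<dots> = \<bar>\<bar>a\<bar> + \<bar>b\<bar>\<bar> powr p"
    by (subst powr_add[symmetric]) simp
  also have "\<dots> \<le> 2 powr p * (\<bar>\<bar>a\<bar>\<bar> powr p + \<bar>\<bar>b\<bar>\<bar> powr p)"
    using assms by (intro abs_add_powr_le) auto
  finally show ?thesis by simp
next
  case True
  then have "a = 0" "b = 0" by auto
  then show ?thesis by simp
qed

lemma gagliardo_integrable:
  "u \<in> Wsp s p \<Longrightarrow> integrable (lebesgue \<Otimes>\<^sub>M lebesgue) (gagliardo s p u)"
  by (auto simp: integrable_iff_bounded Wsp_iff_nn_integral seminorm_pow_eq)

theorem minimizer_weak_subsolution:
  fixes u g :: "'a::euclidean_space \<Rightarrow> real"
  assumes min: "minimizer s p \<Omega> M g u" and p: "1 < p" and \<Omega>: "open \<Omega>" "bounded \<Omega>"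
  shows "weak_subsolution s p \<Omega> u"
proof -
  have uA: "u \<in> admissible s p \<Omega> g" using min by (simp add: minimizer_def)
  then have uW: "u \<in> Wsp s p" by (simp add: admissible_def)
  have [measurable]: "u \<in> borel_measurable lebesgue" using uW by (simp add: Wsp_measurable)
  let ?L2 = "(lebesgue :: 'a measure) \<Otimes>\<^sub>M (lebesgue :: 'a measure)"
  have "energy_form s p u \<phi> \<le> 0" if \<phi>: "\<phi> \<in> Wsp0 s p \<Omega>" and \<phi>0: "AE x in lebesgue. 0 \<le> \<phi> x" for \<phi>
  proof -
    have \<phi>W: "\<phi> \<in> Wsp s p" using \<phi> by (simp add: Wsp0_def)
    have [measurable]: "\<phi> \<in> borel_measurable lebesgue" using \<phi>W by (simp add: Wsp_measurable)
    define N where "N z = norm (fst z - snd z) powr (real DIM('a) + s * p)" for z :: "'a \<times> 'a"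
    define U where "U z = u (fst z) - u (snd z)" for z
    define \<Phi> where "\<Phi> z = \<phi> (fst z) - \<phi> (snd z)" for z
    \<comment> \<open>The integrand of the energy form of \<open>u - t\<phi>\<close> tested with
      \<open>\<phi>\<close>; at \<open>t = 0\<close> it is that of \<open>u\<close>.\<close>
    define E where "E t z = jp p (U z - t * \<Phi> z) * \<Phi> z / N z" for t z
    have [measurable]: "N \<in> borel_measurable ?L2" "U \<in> borel_measurable ?L2" "\<Phi> \<in> borel_measurable ?L2"
      unfolding N_def U_def \<Phi>_def by measurable
    have [measurable]: "E t \<in> borel_measurable ?L2" for t
      unfolding E_def by measurable
    have N0: "0 \<le> N z" for z by (simp add: N_def)
    have G: "gagliardo s p u z = \<bar>U z\<bar> powr p / N z" "gagliardo s p \<phi> z = \<bar>\<Phi> z\<bar> powr p / N z"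
      "gagliardo s p (\<lambda>x. u x - t * \<phi> x) z = \<bar>U z - t * \<Phi> z\<bar> powr p / N z" for z t
      by (simp_all add: gagliardo_def U_def \<Phi>_def N_def algebra_simps)
    have dom_int: "integrable ?L2 (\<lambda>z. 2 powr p * (gagliardo s p u z + gagliardo s p \<phi> z))"
      using gagliardo_integrable[OF uW] gagliardo_integrable[OF \<phi>W] by simp
    have E_bound: "\<bar>E t z\<bar> \<le> 2 powr p * (gagliardo s p u z + gagliardo s p \<phi> z)" if "0 \<le> t" "t \<le> 1" for t z
      using divide_right_mono[OF abs_jp_mult_le[of p t "U z" "\<Phi> z"] N0[of z]] that p N0[of z]
      by (simp add: E_def G add_divide_distrib distrib_left)
    have E_int: "integrable ?L2 (E t)" if "0 \<le> t" "t \<le> 1" for t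
      using E_bound[OF that]
      by (intro Bochner_Integration.integrable_bound[OF dom_int]) (auto intro!: AE_I2 order_trans[OF _ abs_ge_self])
    have E_le: "integral\<^sup>L ?L2 (E t) \<le> 0" if t: "0 < t" "t \<le> 1" for t
    proof -
      define v where "v x = u x - t * \<phi> x" for x
      have vW: "v \<in> Wsp s p"
        using Wsp_diff[OF uW Wsp_cmult[OF \<phi>W]] p by (simp add: v_def[abs_def])
      have [measurable]: "v \<in> borel_measurable lebesgue" using vW by (simp add: Wsp_measurable)
      have "AE x in lebesgue. x \<notin> \<Omega> \<longrightarrow> \<phi> x = 0" using \<phi> by (simp add: Wsp0_def)
      moreover have "AE x in lebesgue. x \<notin> \<Omega> \<longrightarrow> u x = g x" using uA by (simp add: admissible_def)
      ultimately have "AE x in lebesgue. x \<notin> \<Omega> \<longrightarrow> v x = g x"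
        by eventually_elim (simp add: v_def)
      with vW have "v \<in> admissible s p \<Omega> g" by (simp add: admissible_def)
      then have "functional s p \<Omega> M u \<le> functional s p \<Omega> M v" using min by (simp add: minimizer_def)
      then have "seminorm_pow s p u \<le> seminorm_pow s p v"
      proof (rule functional_le_imp_seminorm_le)
        show "AE x in lebesgue. v x \<le> u x \<or> v x \<le> 0"
          using \<phi>0 by eventually_elim (use t in \<open>simp add: v_def\<close>)
      qed (use \<Omega> in auto)
      then have "integral\<^sup>L ?L2 (gagliardo s p u) \<le> integral\<^sup>L ?L2 (gagliardo s p v)"
        unfolding seminorm_pow_eq using gagliardo_integrable[OF uW] gagliardo_integrable[OF vW]
        by (simp add: nn_integral_eq_integral ennreal_le_iff integral_nonneg_AE)
      moreover have "integral\<^sup>L ?L2 (gagliardo s p v) + p * t * integral\<^sup>L ?L2 (E t)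
          = (\<integral>z. gagliardo s p v z + p * t * E t z \<partial>?L2)"
        using gagliardo_integrable[OF vW] E_int t by simp
      moreover have "\<dots> \<le> integral\<^sup>L ?L2 (gagliardo s p u)"
      proof (rule integral_mono)
        \<comment> \<open>The tangent is taken at \<open>U z - t * \<Phi> z\<close>, the difference
          belonging to \<open>v\<close>, and evaluated at \<open>U z\<close>. Together with
          minimality this leaves \<open>p * t\<close> times the integral of \<open>E t\<close> at
          most 0.\<close>
        show "gagliardo s p v z + p * t * E t z \<le> gagliardo s p u z" for z
          using divide_right_mono[OF abs_powr_tangent_le[OF p, of "U z - t * \<Phi> z" "U z"] N0[of z]]
          by (simp add: G v_def[abs_def] E_def add_divide_distrib mult_ac)
      qed (use gagliardo_integrable[OF uW] gagliardo_integrable[OF vW] E_int t in auto)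
      ultimately have "p * t * integral\<^sup>L ?L2 (E t) \<le> 0" by linarith
      then show ?thesis using p t by (simp add: mult_le_0_iff)
    qed
    define \<tau> where "\<tau> k = 1 / real (Suc k)" for k
    have \<tau>: "0 < \<tau> k" "\<tau> k \<le> 1" for k by (auto simp: \<tau>_def)
    have \<tau>_lim: "\<tau> \<longlonglongrightarrow> 0" unfolding \<tau>_def by (rule LIMSEQ_Suc[OF lim_1_over_n])
    \<comment> \<open>The sign is known only for \<open>t > 0\<close>; continuity of
      \<open>jp\<close> and the majorant uniform in \<open>t\<close> carry it to
      \<open>t = 0\<close>.\<close>
    have "(\<lambda>k. integral\<^sup>L ?L2 (E (\<tau> k))) \<longlonglongrightarrow> integral\<^sup>L ?L2 (E 0)"
    proof (rule integral_dominated_convergence[OF _ _ dom_int])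
      show "AE z in ?L2. (\<lambda>k. E (\<tau> k) z) \<longlonglongrightarrow> E 0 z"
      proof (rule AE_I2)
        fix z
        have "(\<lambda>k. U z - \<tau> k * \<Phi> z) \<longlonglongrightarrow> U z - 0 * \<Phi> z"
          by (intro tendsto_intros \<tau>_lim)
        from isCont_tendsto_compose[OF isCont_jp[OF p] this]
        show "(\<lambda>k. E (\<tau> k) z) \<longlonglongrightarrow> E 0 z"
          unfolding E_def divide_inverse by (intro tendsto_mult_right)
      qed
      show "AE z in ?L2. norm (E (\<tau> k) z) \<le> 2 powr p * (gagliardo s p u z + gagliardo s p \<phi> z)" for k
        using E_bound \<tau>[of k] by (auto simp: less_imp_le)
    qed auto
    then have "integral\<^sup>L ?L2 (E 0) \<le> 0"
      by (rule LIMSEQ_le_const2) (use E_le \<tau> in auto)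
    then show ?thesis
      by (simp add: energy_form_def E_def[abs_def] U_def \<Phi>_def N_def case_prod_unfold)
  qed
  then show ?thesis using uW by (simp add: weak_subsolution_def)
qed

theorem theorem1p1:
  fixes p s M :: real
    and \<Omega> :: "(real ^ 'n) set"
    and g :: "real ^ 'n \<Rightarrow> real"
  assumes "p \<ge> 2"
    and "0 < s" and "s < 1"
    and "M > 0"
    and "domain \<Omega>" and "bounded \<Omega>"
    and "g \<in> Wsp s p"
    and "AE x in lebesgue. x \<notin> \<Omega> \<longrightarrow> g x \<ge> 0"
  shows "(\<exists>u. minimizer s p \<Omega> M g u) \<and>
    (\<forall>u. minimizer s p \<Omega> M g u \<longrightarrow>
      (AE x in lebesgue. u x \<ge> 0) \<and> weak_subsolution s p \<Omega> u)"
proof (intro conjI allI impI)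
  have "open \<Omega>" using assms(5) by (simp add: domain_def)
  show "\<exists>u. minimizer s p \<Omega> M g u"
    using assms \<open>open \<Omega>\<close> by (intro minimizer_exists) auto
  fix u assume u: "minimizer s p \<Omega> M g u"
  show "AE x in lebesgue. u x \<ge> 0"
    by (rule minimizer_nonneg[OF u]) (use assms \<open>open \<Omega>\<close> in auto)
  show "weak_subsolution s p \<Omega> u"
    by (rule minimizer_weak_subsolution[OF u]) (use assms \<open>open \<Omega>\<close> in auto)
qed

end
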